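(* Let $N\in\mathbb{N}$, $T>0$, let $c_2,c_{1,1},\dots,c_{1,N}\in C([0,T];\mathbb{R})$ and consider $$\widetilde P=D_t-ic_2(t)\Delta_x+\sum_{j=1}^N i\,c_{1,j}(t)D_{x_j}.$$ Suppose there is $t^\star\in[0,T]$ such that $c_2(t^\star)>0$. Then there exist $f\in C([0,T];C^\omega(\mathbb{T}^N))$ and $g\in C^\omega(\mathbb{T}^N)$ for which there is no solution in $C([0,T];C^\omega(\mathbb{T}^N))$ of the Cauchy problem $\widetilde Pu(t,x)=f(t,x)$, $u(0,x)=g(x)$, $t\in[0,T]$, $x\in\mathbb{T}^N$.
   Context: $\mathbb{T}^N=\mathbb{R}^N/2\pi\mathbb{Z}^N$, $D_t=\frac1i\partial_t$, $D_{x_j}=\frac1i\partial_{x_j}$, $\Delta_x=\sum_j\partial_{x_j}^2$. $C^\omega(\mathbb{T}^N)$ is the space of $f\in C^\infty(\mathbb{T}^N)$ for which there are $C,h>0$ with $|D^\alpha f(x)|\le Ch^{|\alpha|}|\alpha|!$ for all multi-indices $\alpha$ and all $x$. With $\|f\|_{h}=\sup_\alpha \|D^\alpha f\|_\infty/(h^{|\alpha|}|\alpha|!)$, it carries the (locally convex) inductive limit topology of the Banach spaces $\{f:\|f\|_{h}<\infty\}$, $h\to\infty$. $C([0,T];X)$ denotes the continuous maps $[0,T]\to X$. A function $u\in C([0,T];C^\omega(\mathbb{T}^N))$ solves the Cauchy problem if $u(0)=g$ and $\widetilde Pu=f$ holds with $D_tu$ understood as the weak derivative in $t$ on $(0,T)$: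 $\langle D_tu,\varphi\rangle=\int_0^T u(t)(-D_t\varphi(t))\,dt$ for $\varphi\in C_c^\infty((0,T))$. *)

theory Defs
  imports "HOL-Analysis.Analysis"
begin

section \<open>Differential calculus for complex-valued functions\<close>

definition dir_deriv :: "'a::real_normed_vector \<Rightarrow> ('a \<Rightarrow> complex) \<Rightarrow> 'a \<Rightarrow> complex" where
  "dir_deriv v f x = vector_derivative (\<lambda>s. f (x + s *\<^sub>R v)) (at 0)"

definition D_dir :: "'a::real_normed_vector \<Rightarrow> ('a \<Rightarrow> complex) \<Rightarrow> 'a \<Rightarrow> complex" where
  "D_dir v f x = (1 / \<i>) * dir_deriv v f x"

text \<open>Total differentiability of all iterated partial derivatives is equivalent to existence and
  continuity of all iterated partial derivatives.\<close>

definition smooth :: "('a::euclidean_space \<Rightarrow> complex) \<Rightarrow> bool" where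
  "smooth f \<longleftrightarrow> (\<forall>vs. set vs \<subseteq> Basis \<longrightarrow> (\<forall>x. foldr dir_deriv vs f differentiable (at x)))"

definition D_coord :: "'n::finite \<Rightarrow> (real^'n \<Rightarrow> complex) \<Rightarrow> real^'n \<Rightarrow> complex" where
  "D_coord j = D_dir (axis j 1)"

definition laplacian :: "(real^'n::finite \<Rightarrow> complex) \<Rightarrow> real^'n \<Rightarrow> complex" where
  "laplacian f x = (\<Sum>j\<in>UNIV. dir_deriv (axis j 1) (dir_deriv (axis j 1) f) x)"

text \<open>A multi-index is a function \<open>\<alpha> :: 'n \<Rightarrow> nat\<close>. The index type carries no order, so an arbitrary
  but fixed enumeration of the coordinates is chosen to compose the partial derivatives; on smooth
  functions the choice does not matter.\<close>

definition coords :: "'n::finite list" where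
  "coords = (SOME js. distinct js \<and> set js = UNIV)"

definition D_multi :: "('n::finite \<Rightarrow> nat) \<Rightarrow> (real^'n \<Rightarrow> complex) \<Rightarrow> real^'n \<Rightarrow> complex" where
  "D_multi \<alpha> f = foldr (\<lambda>j. D_coord j ^^ \<alpha> j) coords f"

definition midx_size :: "('n::finite \<Rightarrow> nat) \<Rightarrow> nat" where
  "midx_size \<alpha> = (\<Sum>j\<in>UNIV. \<alpha> j)"

section \<open>Analytic functions on the torus\<close>

text \<open>Functions on the torus are represented by periodic functions on \<open>real^'n\<close>.\<close>

definition smooth_torus :: "(real^'n::finite \<Rightarrow> complex) set" where
  "smooth_torus = {f. smooth f \<and>
     (\<forall>x k. (\<forall>j. k $ j \<in> \<int>) \<longrightarrow> f (x + (2 * pi) *\<^sub>R k) = f x)}"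

definition Comega :: "(real^'n::finite \<Rightarrow> complex) set" where
  "Comega = {f \<in> smooth_torus. \<exists>C>0. \<exists>h>0. \<forall>\<alpha> x.
     cmod (D_multi \<alpha> f x) \<le> C * h ^ midx_size \<alpha> * fact (midx_size \<alpha>)}"

definition hnorm :: "real \<Rightarrow> (real^'n::finite \<Rightarrow> complex) \<Rightarrow> ennreal" where
  "hnorm h f = (SUP \<alpha>. (SUP x. ennreal (cmod (D_multi \<alpha> f x))) /
     ennreal (h ^ midx_size \<alpha> * fact (midx_size \<alpha>)))"

definition hspace :: "real \<Rightarrow> (real^'n::finite \<Rightarrow> complex) set" where
  "hspace h = {f \<in> smooth_torus. hnorm h f < \<infinity>}"

definition abs_convex :: "('a \<Rightarrow> complex) set \<Rightarrow> bool" where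
  "abs_convex V \<longleftrightarrow> (\<forall>v\<in>V. \<forall>w\<in>V. \<forall>a b. cmod a + cmod b \<le> 1 \<longrightarrow>
     (\<lambda>x. a * v x + b * w x) \<in> V)"

text \<open>The locally convex inductive limit topology: a basis of neighbourhoods of zero consists of
  the absolutely convex sets whose trace on each of the Banach spaces \<open>hspace h\<close> is a neighbourhood
  of zero there.\<close>

definition Comega_zero_nhds :: "(real^'n::finite \<Rightarrow> complex) set set" where
  "Comega_zero_nhds = {V. V \<subseteq> Comega \<and> abs_convex V \<and>
     (\<forall>h>0. \<exists>\<epsilon>>0. {f \<in> hspace h. hnorm h f < ennreal \<epsilon>} \<subseteq> V)}"

definition Comega_open :: "(real^'n::finite \<Rightarrow> complex) set \<Rightarrow> bool" where
  "Comega_open U \<longleftrightarrow> U \<subseteq> Comega \<and>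
     (\<forall>f\<in>U. \<exists>V\<in>Comega_zero_nhds. \<forall>v\<in>V. (\<lambda>x. f x + v x) \<in> U)"

definition Comega_top :: "(real^'n::finite \<Rightarrow> complex) topology" where
  "Comega_top = topology Comega_open"

lemma Comega_zero_nhds_Int:
  assumes "V \<in> Comega_zero_nhds" "W \<in> Comega_zero_nhds"
  shows "V \<inter> W \<in> Comega_zero_nhds"
proof -
  have "\<exists>\<epsilon>>0. {f \<in> hspace h. hnorm h f < ennreal \<epsilon>} \<subseteq> V \<inter> W" if h: "h > 0" for h
  proof -
    obtain d e where d: "d > 0" "{f \<in> hspace h. hnorm h f < ennreal d} \<subseteq> V"
      and e: "e > 0" "{f \<in> hspace h. hnorm h f < ennreal e} \<subseteq> W"
      using assms h unfolding Comega_zero_nhds_def by blast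
    have "ennreal (min d e) \<le> ennreal d" "ennreal (min d e) \<le> ennreal e"
      by (auto intro!: ennreal_leI)
    then have "{f \<in> hspace h. hnorm h f < ennreal (min d e)} \<subseteq> V \<inter> W"
      using d(2) e(2) by (auto dest: order_less_le_trans)
    then show ?thesis
      using d(1) e(1) by (intro exI[of _ "min d e"]) auto
  qed
  then show ?thesis
    using assms unfolding Comega_zero_nhds_def abs_convex_def by auto
qed

lemma istopology_Comega_open: "istopology Comega_open"
  unfolding istopology_def
proof (intro conjI allI impI)
  fix S U :: "(real^'n \<Rightarrow> complex) set"
  assume S: "Comega_open S" and U: "Comega_open U"
  show "Comega_open (S \<inter> U)"
    unfolding Comega_open_def
  proof (intro conjI ballI)
    show "S \<inter> U \<subseteq> Comega" using S by (auto simp: Comega_open_def)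
    fix f assume f: "f \<in> S \<inter> U"
    obtain V W where "V \<in> Comega_zero_nhds" "\<forall>v\<in>V. (\<lambda>x. f x + v x) \<in> S"
      "W \<in> Comega_zero_nhds" "\<forall>v\<in>W. (\<lambda>x. f x + v x) \<in> U"
      using S U f unfolding Comega_open_def by blast
    then show "\<exists>V\<in>Comega_zero_nhds. \<forall>v\<in>V. (\<lambda>x. f x + v x) \<in> S \<inter> U"
      by (intro bexI[of _ "V \<inter> W"]) (auto intro: Comega_zero_nhds_Int)
  qed
next
  fix K :: "(real^'n \<Rightarrow> complex) set set"
  assume "\<forall>S\<in>K. Comega_open S"
  then show "Comega_open (\<Union>K)"
    unfolding Comega_open_def by (meson Sup_le_iff UnionE UnionI)
qed

lemma openin_Comega_top: "openin Comega_top = Comega_open"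
  by (simp add: Comega_top_def istopology_Comega_open topology_inverse')

lemma dir_deriv_add:
  assumes "\<And>x. f differentiable (at x)" "\<And>x. g differentiable (at x)"
  shows "dir_deriv v (\<lambda>x. f x + g x) = (\<lambda>x. dir_deriv v f x + dir_deriv v g x)"
proof
  fix x
  have *: "(\<lambda>s::real. k (x + s *\<^sub>R v)) differentiable (at 0)"
    if "\<And>x. k differentiable (at x)" for k :: "'a \<Rightarrow> complex"
  proof -
    have "(\<lambda>s::real. x + s *\<^sub>R v) differentiable (at 0)"
      by (intro derivative_intros differentiableI_vector) (auto intro!: derivative_eq_intros)
    then have "k \<circ> (\<lambda>s::real. x + s *\<^sub>R v) differentiable (at 0)"
      by (rule differentiable_chain_at) (rule that)
    then show ?thesis by (simp add: o_def)
  qed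
  show "dir_deriv v (\<lambda>x. f x + g x) x = dir_deriv v f x + dir_deriv v g x"
    unfolding dir_deriv_def
    by (rule vector_derivative_add_at) (intro * assms)+
qed

lemma dir_deriv_cmult:
  assumes "\<And>x. f differentiable (at x)"
  shows "dir_deriv v (\<lambda>x. c * f x) = (\<lambda>x. c * dir_deriv v f x)"
proof
  fix x
  have "(\<lambda>s::real. x + s *\<^sub>R v) differentiable (at 0)"
    by (auto intro!: derivative_intros)
  then have "f \<circ> (\<lambda>s::real. x + s *\<^sub>R v) differentiable (at 0)"
    by (rule differentiable_chain_at) (rule assms)
  then show "dir_deriv v (\<lambda>x. c * f x) x = c * dir_deriv v f x"
    unfolding dir_deriv_def by (simp add: o_def vector_derivative_mult_at)
qed

lemma smooth_differentiable: "smooth f \<Longrightarrow> f differentiable (at x)"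
  unfolding smooth_def by (metis empty_subsetI foldr.simps(1) id_apply list.set(1))

lemma smooth_dir_deriv: "smooth f \<Longrightarrow> v \<in> Basis \<Longrightarrow> smooth (dir_deriv v f)"
  unfolding smooth_def
proof (intro allI impI)
  fix vs :: "'a list" and x
  assume f: "\<forall>vs. set vs \<subseteq> Basis \<longrightarrow> (\<forall>x. foldr dir_deriv vs f differentiable at x)"
    and v: "v \<in> Basis" and vs: "set vs \<subseteq> Basis"
  then show "foldr dir_deriv vs (dir_deriv v f) differentiable at x"
    using f[rule_format, of "vs @ [v]" x] by simp
qed

lemma smooth_add:
  assumes "smooth f" "smooth g"
  shows "smooth (\<lambda>x. f x + g x)"
proof -
  have "foldr dir_deriv vs (\<lambda>x. f x + g x) = (\<lambda>x. foldr dir_deriv vs f x + foldr dir_deriv vs g x)"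
    if "set vs \<subseteq> Basis" for vs
    using that by (induction vs) (use assms in \<open>auto simp: smooth_def dir_deriv_add\<close>)
  then show ?thesis
    using assms by (simp add: smooth_def)
qed

lemma smooth_cmult:
  assumes "smooth f"
  shows "smooth (\<lambda>x. c * f x)"
proof -
  have "foldr dir_deriv vs (\<lambda>x. c * f x) = (\<lambda>x. c * foldr dir_deriv vs f x)"
    if "set vs \<subseteq> Basis" for vs
    using that by (induction vs) (use assms in \<open>auto simp: smooth_def dir_deriv_cmult\<close>)
  then show ?thesis
    using assms by (simp add: smooth_def)
qed

lemma smooth_D_coord: "smooth f \<Longrightarrow> smooth (D_coord j f)"
  unfolding D_coord_def D_dir_def[abs_def]
  by (intro smooth_cmult smooth_dir_deriv) (auto simp: axis_in_Basis_iff)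

lemma smooth_lincomb: "smooth f \<Longrightarrow> smooth g \<Longrightarrow> smooth (\<lambda>x. a * f x + b * g x)"
  by (intro smooth_add smooth_cmult)

lemma D_coord_lincomb:
  assumes "smooth f" "smooth g"
  shows "D_coord j (\<lambda>x. a * f x + b * g x) = (\<lambda>x. a * D_coord j f x + b * D_coord j g x)"
proof -
  have "dir_deriv (axis j 1) (\<lambda>x. a * f x + b * g x)
      = (\<lambda>x. dir_deriv (axis j 1) (\<lambda>x. a * f x) x + dir_deriv (axis j 1) (\<lambda>x. b * g x) x)"
    by (intro dir_deriv_add smooth_differentiable smooth_cmult assms)
  then show ?thesis
    unfolding D_coord_def D_dir_def[abs_def]
    by (simp add: dir_deriv_cmult smooth_differentiable assms algebra_simps)
qed

lemma D_multi_lincomb: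
  assumes "smooth f" "smooth g"
  shows "D_multi \<alpha> (\<lambda>x. a * f x + b * g x) = (\<lambda>x. a * D_multi \<alpha> f x + b * D_multi \<alpha> g x)"
proof -
  have pow: "smooth ((D_coord j ^^ n) f) \<and> smooth ((D_coord j ^^ n) g) \<and>
      (D_coord j ^^ n) (\<lambda>x. a * f x + b * g x)
        = (\<lambda>x. a * (D_coord j ^^ n) f x + b * (D_coord j ^^ n) g x)"
    if "smooth f" "smooth g" for j n and f g :: "real^'n \<Rightarrow> complex"
    using that by (induction n) (auto simp: smooth_D_coord D_coord_lincomb)
  let ?F = "\<lambda>js f. foldr (\<lambda>j. D_coord j ^^ \<alpha> j) js f"
  have "smooth (?F js f) \<and> smooth (?F js g) \<and>
      ?F js (\<lambda>x. a * f x + b * g x) = (\<lambda>x. a * ?F js f x + b * ?F js g x)" for js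
    by (induction js) (use assms pow in auto)
  then show ?thesis by (simp add: D_multi_def)
qed

lemma Comega_lincomb:
  assumes "f \<in> Comega" "g \<in> Comega"
  shows "(\<lambda>x. a * f x + b * g x) \<in> Comega"
proof -
  obtain C h where f: "f \<in> smooth_torus" "C > 0" "h > 0"
    "\<And>\<alpha> x. cmod (D_multi \<alpha> f x) \<le> C * h ^ midx_size \<alpha> * fact (midx_size \<alpha>)"
    using assms(1) by (auto simp: Comega_def)
  obtain C' h' where g: "g \<in> smooth_torus" "C' > 0" "h' > 0"
    "\<And>\<alpha> x. cmod (D_multi \<alpha> g x) \<le> C' * h' ^ midx_size \<alpha> * fact (midx_size \<alpha>)"
    using assms(2) by (auto simp: Comega_def)
  define B where "B = cmod a * C + cmod b * C' + 1"
  define H where "H = max h h'"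
  have B: "B > 0" and H: "H > 0" "h \<le> H" "h' \<le> H"
    using f(2,3) g(2,3) by (auto simp: B_def H_def intro!: add_nonneg_pos)
  have "cmod (D_multi \<alpha> (\<lambda>x. a * f x + b * g x) x) \<le> B * H ^ midx_size \<alpha> * fact (midx_size \<alpha>)"
    for \<alpha> x
  proof -
    let ?m = "midx_size \<alpha>"
    have "cmod (D_multi \<alpha> (\<lambda>x. a * f x + b * g x) x)
        \<le> cmod a * cmod (D_multi \<alpha> f x) + cmod b * cmod (D_multi \<alpha> g x)"
      using f(1) g(1) norm_triangle_ineq[of "a * D_multi \<alpha> f x" "b * D_multi \<alpha> g x"]
      by (simp add: D_multi_lincomb smooth_torus_def norm_mult)
    also have "\<dots> \<le> cmod a * (C * h ^ ?m * fact ?m) + cmod b * (C' * h' ^ ?m * fact ?m)"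
      by (intro add_mono mult_left_mono f g norm_ge_zero)
    also have "\<dots> \<le> cmod a * (C * H ^ ?m * fact ?m) + cmod b * (C' * H ^ ?m * fact ?m)"
      using f(2,3) g(2,3) H by (intro add_mono mult_right_mono mult_left_mono power_mono) auto
    also have "\<dots> \<le> B * H ^ ?m * fact ?m"
      using H by (simp add: B_def algebra_simps)
    finally show ?thesis .
  qed
  moreover have "(\<lambda>x. a * f x + b * g x) \<in> smooth_torus"
    using f(1) g(1) by (auto simp: smooth_torus_def smooth_lincomb)
  ultimately show ?thesis
    using B H(1) unfolding Comega_def by blast
qed

lemma hspace_subset_Comega:
  assumes h: "h > 0"
  shows "hspace h \<subseteq> Comega"
proof
  fix f :: "real^'n \<Rightarrow> complex" assume f: "f \<in> hspace h"
  then obtain C where C: "hnorm h f = ennreal C" "C \<ge> 0"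
    by (auto simp: hspace_def elim: less_top_ennreal[THEN iffD1, THEN exE])
  have "cmod (D_multi \<alpha> f x) \<le> (C + 1) * h ^ midx_size \<alpha> * fact (midx_size \<alpha>)" for \<alpha> x
  proof -
    let ?q = "h ^ midx_size \<alpha> * fact (midx_size \<alpha>)"
    have q: "?q > 0" using h by simp
    have "ennreal (cmod (D_multi \<alpha> f x) / ?q) = ennreal (cmod (D_multi \<alpha> f x)) / ennreal ?q"
      using q by (simp add: divide_ennreal)
    also have "\<dots> \<le> (SUP x. ennreal (cmod (D_multi \<alpha> f x))) / ennreal ?q"
      by (intro divide_right_mono_ennreal SUP_upper) auto
    also have "\<dots> \<le> hnorm h f"
      unfolding hnorm_def by (rule SUP_upper) auto
    finally have "cmod (D_multi \<alpha> f x) / ?q \<le> C"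
      using C by simp
    then have "cmod (D_multi \<alpha> f x) \<le> C * ?q"
      using q by (simp add: pos_divide_le_eq)
    also have "\<dots> \<le> (C + 1) * ?q"
      using q by (intro mult_right_mono) auto
    finally show ?thesis by (simp add: mult.assoc)
  qed
  moreover have "C + 1 > 0" using C(2) by simp
  ultimately show "f \<in> Comega"
    using f h unfolding Comega_def hspace_def by blast
qed

lemma topspace_Comega_top: "topspace Comega_top = Comega"
proof -
  have "(Comega :: (real^'n \<Rightarrow> complex) set) \<in> Comega_zero_nhds"
    unfolding Comega_zero_nhds_def abs_convex_def
  proof (intro CollectI conjI ballI allI impI order_refl)
    fix h :: real assume "h > 0"
    then have "{f \<in> hspace h. hnorm h f < ennreal 1} \<subseteq> (Comega :: (real^'n \<Rightarrow> complex) set)"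
      using hspace_subset_Comega by blast
    then show "\<exists>\<epsilon>>0. {f \<in> hspace h. hnorm h f < ennreal \<epsilon>} \<subseteq> (Comega :: (real^'n \<Rightarrow> complex) set)"
      by (intro exI[of _ 1]) simp
  qed (rule Comega_lincomb)
  moreover have "(\<lambda>x. f x + g x) \<in> Comega" if "f \<in> Comega" "g \<in> Comega"
    for f g :: "real^'n \<Rightarrow> complex"
    using Comega_lincomb[OF that, of 1 1] by simp
  ultimately have "Comega_open (Comega :: (real^'n \<Rightarrow> complex) set)"
    unfolding Comega_open_def by blast
  moreover have "U \<subseteq> Comega" if "Comega_open U" for U :: "(real^'n \<Rightarrow> complex) set"
    using that by (simp add: Comega_open_def)
  ultimately show ?thesis
    unfolding topspace_def openin_Comega_top by blast
qed

section \<open>The Cauchy problem\<close>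

definition C_Comega :: "real \<Rightarrow> (real \<Rightarrow> real^'n::finite \<Rightarrow> complex) set" where
  "C_Comega T = {u. continuous_map (top_of_set {0..T}) Comega_top u}"

definition Comega_dual :: "((real^'n::finite \<Rightarrow> complex) \<Rightarrow> complex) set" where
  "Comega_dual = {l. continuous_map Comega_top euclidean l \<and>
     (\<forall>f\<in>Comega. \<forall>g\<in>Comega. \<forall>a b. l (\<lambda>x. a * f x + b * g x) = a * l f + b * l g)}"

text \<open>The vector-valued integral \<open>\<integral>\<^sub>0\<^sup>T v(t) dt = I\<close> in the locally convex space \<open>Comega\<close>, characterised
  by duality.\<close>

definition has_Comega_integral ::
    "(real \<Rightarrow> real^'n::finite \<Rightarrow> complex) \<Rightarrow> (real^'n \<Rightarrow> complex) \<Rightarrow> real \<Rightarrow> bool" where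
  "has_Comega_integral v I T \<longleftrightarrow> (\<forall>t\<in>{0..T}. v t \<in> Comega) \<and> I \<in> Comega \<and>
     (\<forall>l\<in>Comega_dual. ((\<lambda>t. l (v t)) has_integral l I) {0..T})"

definition test_fun :: "real \<Rightarrow> (real \<Rightarrow> complex) \<Rightarrow> bool" where
  "test_fun T \<phi> \<longleftrightarrow> smooth \<phi> \<and> compact (closure {t. \<phi> t \<noteq> 0}) \<and>
     closure {t. \<phi> t \<noteq> 0} \<subseteq> {0<..<T}"

definition spatial_op ::
    "(real \<Rightarrow> real) \<Rightarrow> ('n::finite \<Rightarrow> real \<Rightarrow> real) \<Rightarrow> real \<Rightarrow> (real^'n \<Rightarrow> complex) \<Rightarrow> real^'n \<Rightarrow> complex"
  where
  "spatial_op c2 c1 t w x = - \<i> * of_real (c2 t) * laplacian w x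
     + (\<Sum>j\<in>UNIV. \<i> * of_real (c1 j t) * D_coord j w x)"

text \<open>The equation \<open>D\<^sub>t u + spatial_op u = f\<close> holds in the sense of \<open>Comega\<close>-valued distributions on
  \<open>(0,T)\<close>: \<open>I\<close> below is \<open>\<langle>D\<^sub>t u, \<phi>\<rangle>\<close>, while \<open>J\<close> and \<open>K\<close> are the pairings of the remaining terms
  with \<open>\<phi>\<close>.\<close>

definition solves_cauchy ::
    "real \<Rightarrow> (real \<Rightarrow> real) \<Rightarrow> ('n::finite \<Rightarrow> real \<Rightarrow> real) \<Rightarrow> (real \<Rightarrow> real^'n \<Rightarrow> complex) \<Rightarrow>
     (real^'n \<Rightarrow> complex) \<Rightarrow> (real \<Rightarrow> real^'n \<Rightarrow> complex) \<Rightarrow> bool" where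
  "solves_cauchy T c2 c1 f g u \<longleftrightarrow> u \<in> C_Comega T \<and> u 0 = g \<and>
     (\<forall>\<phi>. test_fun T \<phi> \<longrightarrow> (\<exists>I J K.
        has_Comega_integral (\<lambda>t x. u t x * (- D_dir 1 \<phi> t)) I T \<and>
        has_Comega_integral (\<lambda>t x. spatial_op c2 c1 t (u t) x * \<phi> t) J T \<and>
        has_Comega_integral (\<lambda>t x. f t x * \<phi> t) K T \<and>
        (\<forall>x. I x + J x = K x)))"

end

theory Submission
  imports Defs "HOL-Complex_Analysis.Cauchy_Integral_Formula"
begin

text \<open>Take \<open>g = 0\<close> and let \<open>f(t,x) = F(x) = 1 / (1 - exp (i x\<^sub>j - 1))\<close> be constant in time; the Fourier
  coefficients of \<open>F\<close> at the frequencies \<open>n e\<^sub>j\<close> are proportional to \<open>exp (-n)\<close>. The \<open>n e\<^sub>j\<close>-th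
  coefficient of a solution satisfies \<open>y' = a\<^sub>n y + i F\<^sub>n\<close>, \<open>y(0) = 0\<close> with
  \<open>a\<^sub>n(t) = n\<^sup>2 c2(t) + n c1(j,t)\<close>, so that \<open>y(t) = i F\<^sub>n \<integral>\<^sub>0\<^sup>t exp (\<integral>\<^sub>s\<^sup>t a\<^sub>n) ds\<close>. The integrand is
  positive, so there is no cancellation, and at the right end of an interval on which \<open>c2\<close> is bounded
  below by a positive constant the coefficient grows like \<open>exp (d n\<^sup>2 - O(n))\<close>, whereas the Fourier
  coefficients of a single function are bounded.\<close>

section \<open>Smooth step functions\<close>

text \<open>Data at time 0 alone would not suffice: \<open>c2\<close> may be negative before the
  point where it is positive, and then the propagator from time 0 can damp \<open>g\<close> beyond
  recovery. A source that acts at all times feeds every frequency again just before that point, so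
  the obstruction is put into \<open>f\<close> and not into \<open>g\<close>. The source has to be
  analytic, hence its coefficients decay exponentially; a pole at distance 1 from the real axis, at
  z = -i, fixes the rate, which is too slow against a quadratic exponent. The drift
  \<open>c1\<close> costs only O(n) in the exponent, like the decay of the source.

  The equation is given only weakly in time and with values in \<open>Comega\<close>. Fourier
  coefficients are continuous functionals, so they turn it into a scalar weak equation. Passing from
  there to the explicit formula for y takes test functions that approximate indicators of intervals,
  and these are constructed by hand.\<close>

definition flat :: "real poly \<Rightarrow> real \<Rightarrow> real" where
  "flat p x = (if x > 0 then poly p (1 / x) * exp (- (1 / x)) else 0)"

lemma tendsto_poly_times_exp_minus:
  fixes p :: "real poly"
  shows "((\<lambda>y. poly p y * exp (- y)) \<longlongrightarrow> 0) at_top"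
proof -
  have "((\<lambda>y. \<Sum>i\<le>degree p. coeff p i * (y ^ i / exp y)) \<longlongrightarrow> (\<Sum>i\<le>degree p. coeff p i * 0)) at_top"
    by (intro tendsto_intros tendsto_power_div_exp_0)
  then show ?thesis
    by (simp add: poly_altdef sum_distrib_right exp_minus field_simps sum_divide_distrib)
qed

text \<open>With y = 1/x the derivative of p(y) exp (-y) is y^2 (p(y) - p'(y)) exp (-y), and
  \<open>[:0, 0, 1:]\<close> is the polynomial y^2. Carrying the polynomial p along is what closes
  the family under differentiation, also at the gluing point 0.\<close>

lemma flat_has_derivative:
  "(flat p has_real_derivative flat ([:0, 0, 1:] * (p - pderiv p)) x) (at x)"
proof (rule linorder_cases[of x 0])
  assume x: "x < 0"
  have "((\<lambda>x. 0) has_real_derivative 0) (at x)" by simp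
  then have "(flat p has_real_derivative 0) (at x)"
    by (rule has_field_derivative_transform_within_open[where S = "{..<0}"])
       (use x in \<open>auto simp: flat_def\<close>)
  then show ?thesis using x by (simp add: flat_def)
next
  assume x: "x > 0"
  have "((\<lambda>x. poly p (1 / x) * exp (- (1 / x))) has_real_derivative
      flat ([:0, 0, 1:] * (p - pderiv p)) x) (at x)"
    using x by (auto intro!: derivative_eq_intros DERIV_chain2[OF poly_DERIV]
        simp: flat_def field_simps power2_eq_square)
  then show ?thesis
    by (rule has_field_derivative_transform_within_open[where S = "{0<..}"])
       (use x in \<open>auto simp: flat_def\<close>)
next
  assume x: "x = 0"
  have "((\<lambda>h. flat p h / h) \<longlongrightarrow> 0) (at 0)"
    unfolding filterlim_at_split
  proof
    have "((\<lambda>h. 0) \<longlongrightarrow> 0) (at_left (0::real))" by simp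
    then show "((\<lambda>h. flat p h / h) \<longlongrightarrow> 0) (at_left 0)"
      by (rule Lim_transform_eventually) (auto simp: flat_def eventually_at_filter)
  next
    \<comment> \<open>The factor \<open>[:0, 1:]\<close> is the 1/h of the difference quotient,
      absorbed into the polynomial in 1/h.\<close>
    have "((\<lambda>h. poly ([:0, 1:] * p) (inverse h) * exp (- inverse h)) \<longlongrightarrow> 0) (at_right (0::real))"
      by (rule filterlim_compose[OF tendsto_poly_times_exp_minus filterlim_inverse_at_top_right])
    then show "((\<lambda>h. flat p h / h) \<longlongrightarrow> 0) (at_right 0)"
      by (rule Lim_transform_eventually)
         (auto simp: flat_def eventually_at_filter field_simps)
  qed
  then show ?thesis
    using x by (simp add: has_field_derivative_iff flat_def)
qed

text \<open>Every member is smooth because the set is closed under differentiation; closing it under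
  antiderivatives as well makes it contain smooth step functions without further work.\<close>

inductive_set flat_algebra :: "(real \<Rightarrow> real) set" where
  const: "(\<lambda>x. c) \<in> flat_algebra"
| flat: "flat p \<in> flat_algebra"
| add: "f \<in> flat_algebra \<Longrightarrow> g \<in> flat_algebra \<Longrightarrow> (\<lambda>x. f x + g x) \<in> flat_algebra"
| mult: "f \<in> flat_algebra \<Longrightarrow> g \<in> flat_algebra \<Longrightarrow> (\<lambda>x. f x * g x) \<in> flat_algebra"
| affine: "f \<in> flat_algebra \<Longrightarrow> (\<lambda>x. f (a * x + b)) \<in> flat_algebra"
| antiderivative: "f \<in> flat_algebra \<Longrightarrow> (\<And>x. (F has_real_derivative f x) (at x)) \<Longrightarrow> F \<in> flat_algebra"

lemma flat_algebra_derivative: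
  assumes "f \<in> flat_algebra"
  shows "\<exists>f'\<in>flat_algebra. \<forall>x. (f has_real_derivative f' x) (at x)"
  using assms
proof induction
  case (const c)
  show ?case by (rule bexI[OF _ flat_algebra.const[of 0]]) auto
next
  case (flat p)
  show ?case using flat_has_derivative flat_algebra.flat by blast
next
  case (add f g)
  then obtain f' g' where *: "f' \<in> flat_algebra" "g' \<in> flat_algebra"
    "\<And>x. (f has_real_derivative f' x) (at x)" "\<And>x. (g has_real_derivative g' x) (at x)" by blast
  then show ?case
    by (intro bexI[OF _ flat_algebra.add[OF *(1,2)]]) (auto intro!: derivative_eq_intros)
next
  case (mult f g)
  then obtain f' g' where *: "f' \<in> flat_algebra" "g' \<in> flat_algebra"
    "\<And>x. (f has_real_derivative f' x) (at x)" "\<And>x. (g has_real_derivative g' x) (at x)" by blast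
  have "(\<lambda>x. f' x * g x + g' x * f x) \<in> flat_algebra"
    by (intro flat_algebra.add flat_algebra.mult * mult)
  then show ?case
    by (rule bexI[rotated]) (rule allI, rule DERIV_mult[OF *(3,4)])
next
  case (affine f a b)
  then obtain f' where *: "f' \<in> flat_algebra" "\<And>x. (f has_real_derivative f' x) (at x)" by blast
  have "(\<lambda>x. f' (a * x + b) * a) \<in> flat_algebra"
    by (rule flat_algebra.mult[OF flat_algebra.affine[OF *(1)] flat_algebra.const])
  moreover have "((\<lambda>x. f (a * x + b)) has_real_derivative f' (a * x + b) * a) (at x)" for x
  proof -
    have "((\<lambda>x. a * x + b) has_real_derivative a) (at x)"
      by (auto intro!: derivative_eq_intros)
    then show ?thesis by (rule DERIV_chain2[OF *(2)])
  qed
  ultimately show ?case by (intro bexI[of _ "\<lambda>x. f' (a * x + b) * a"]) auto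
next
  case (antiderivative f F)
  then show ?case by blast
qed

lemma dir_deriv_one:
  fixes f :: "real \<Rightarrow> complex"
  assumes "(f has_vector_derivative f') (at x)"
  shows "dir_deriv 1 f x = f'"
proof -
  have "((\<lambda>s. x + s) has_vector_derivative 1) (at 0)"
    by (auto intro!: derivative_eq_intros)
  from vector_diff_chain_at[OF this, of f f'] assms
  have "((\<lambda>s. f (x + s)) has_vector_derivative f') (at 0)"
    by (simp add: o_def)
  then show ?thesis
    by (simp add: dir_deriv_def vector_derivative_at)
qed

lemma smooth_flat_algebra:
  assumes "f \<in> flat_algebra"
  shows "smooth (\<lambda>x. complex_of_real (f x))"
proof -
  have "\<exists>g\<in>flat_algebra. foldr dir_deriv vs (\<lambda>x. complex_of_real (f x)) = (\<lambda>x. complex_of_real (g x))"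
    if "set vs \<subseteq> Basis" for vs
    using that
  proof (induction vs)
    case (Cons v vs)
    then obtain g where g: "g \<in> flat_algebra"
      "foldr dir_deriv vs (\<lambda>x. complex_of_real (f x)) = (\<lambda>x. complex_of_real (g x))" by auto
    obtain g' where g': "g' \<in> flat_algebra" "\<And>x. (g has_real_derivative g' x) (at x)"
      using flat_algebra_derivative[OF g(1)] by blast
    have "dir_deriv 1 (\<lambda>x. complex_of_real (g x)) = (\<lambda>x. complex_of_real (g' x))"
      using g'(2) by (intro ext dir_deriv_one has_vector_derivative_of_real)
        (simp add: has_real_derivative_iff_has_vector_derivative)
    then show ?case using Cons.prems g(2) g'(1) by auto
  qed (use assms in auto)
  moreover have "(\<lambda>x. complex_of_real (g x)) differentiable (at x)" if g: "g \<in> flat_algebra" for g x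
  proof -
    obtain g' where "(g has_real_derivative g' x) (at x)"
      using flat_algebra_derivative[OF g] by blast
    then show ?thesis
      using differentiableI_vector has_vector_derivative_of_real
        has_real_derivative_iff_has_vector_derivative by blast
  qed
  ultimately show ?thesis
    unfolding smooth_def by fastforce
qed

text \<open>\<open>\<rho>\<close> is the bump exp (-1/x) exp (-1/(1-x)) on (0,1) and
  \<open>\<Psi>\<close> an antiderivative of it. The total mass \<open>\<Psi> 1 - \<Psi> 0\<close>
  is not normalised; it is divided out where the step is used.\<close>

lemma flat_algebra_step:
  obtains \<Psi> \<rho> :: "real \<Rightarrow> real" where
    "\<Psi> \<in> flat_algebra" "\<rho> \<in> flat_algebra" "\<And>x. (\<Psi> has_real_derivative \<rho> x) (at x)"
    "\<And>x. \<rho> x \<ge> 0" "\<And>x. x \<notin> {0..1} \<Longrightarrow> \<rho> x = 0"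
    "\<And>x. x \<le> 0 \<Longrightarrow> \<Psi> x = \<Psi> 0" "\<And>x. x \<ge> 1 \<Longrightarrow> \<Psi> x = \<Psi> 1" "\<Psi> 0 < \<Psi> 1"
proof -
  define \<rho> where "\<rho> x = flat 1 x * flat 1 ((-1) * x + 1)" for x
  have \<rho>: "\<rho> \<in> flat_algebra"
    unfolding \<rho>_def
    by (rule flat_algebra.mult[OF flat_algebra.flat flat_algebra.affine[OF flat_algebra.flat]])
  have "isCont \<rho> x" for x
    using flat_algebra_derivative[OF \<rho>] DERIV_isCont by blast
  \<comment> \<open>The infinite endpoints give one antiderivative on the whole line.\<close>
  then have "\<exists>F. \<forall>x::real. - \<infinity> < ereal x \<longrightarrow> ereal x < \<infinity> \<longrightarrow> (F has_vector_derivative \<rho> x) (at x)"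
    by (intro einterval_antiderivative) auto
  then obtain \<Psi> where \<Psi>: "\<And>x. (\<Psi> has_real_derivative \<rho> x) (at x)"
    by (auto simp: has_real_derivative_iff_has_vector_derivative)
  have nonneg: "\<rho> x \<ge> 0" for x by (simp add: \<rho>_def flat_def)
  have zero: "\<rho> x = 0" if "x \<notin> {0<..<1}" for x
    using that by (auto simp: \<rho>_def flat_def)
  have left: "\<Psi> x = \<Psi> 0" if "x \<le> 0" for x
  proof (cases "x = 0")
    case False
    have "(\<Psi> has_real_derivative 0) (at z)" if "z \<le> 0" for z
      using \<Psi>[of z] zero[of z] that by simp
    moreover have "continuous_on {x..0} \<Psi>"
      using \<Psi> DERIV_isCont continuous_at_imp_continuous_on by blast
    ultimately show ?thesis using DERIV_isconst_end[of x 0 \<Psi>] that False by simp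
  qed simp
  have right: "\<Psi> x = \<Psi> 1" if "x \<ge> 1" for x
  proof (cases "x = 1")
    case False
    have "(\<Psi> has_real_derivative 0) (at z)" if "z \<ge> 1" for z
      using \<Psi>[of z] zero[of z] that by simp
    moreover have "continuous_on {1..x} \<Psi>"
      using \<Psi> DERIV_isCont continuous_at_imp_continuous_on by blast
    ultimately show ?thesis using DERIV_isconst_end[of 1 x \<Psi>] that False by simp
  qed simp
  have "\<Psi> 0 < \<Psi> 1"
  proof (rule DERIV_pos_imp_increasing_open[of 0 1])
    show "\<And>x. 0 < x \<Longrightarrow> x < 1 \<Longrightarrow> \<exists>y. (\<Psi> has_real_derivative y) (at x) \<and> 0 < y"
      using \<Psi> by (force simp: \<rho>_def flat_def)
    show "continuous_on {0..1} \<Psi>"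
      using \<Psi> DERIV_isCont continuous_at_imp_continuous_on by blast
  qed simp
  moreover have "\<Psi> \<in> flat_algebra" using \<rho> \<Psi> by (rule flat_algebra.antiderivative)
  moreover have "\<rho> x = 0" if "x \<notin> {0..1}" for x
    using that zero[of x] by auto
  ultimately show thesis
    using that[OF _ \<rho> \<Psi> nonneg _ left right] by blast
qed

section \<open>Weak solutions of ordinary differential equations\<close>

text \<open>The function rises on [s1, s1 + e] and falls on [s2, s2 + e]. Both transitions lie to
  the right of their base points, so the support stays inside (0, T) as soon as 0 < s1 and s2 + e <
  T.\<close>

lemma test_fun_step:
  assumes step: "\<Psi> \<in> flat_algebra" "\<And>x. (\<Psi> has_real_derivative \<rho> x) (at x)"
    "\<And>x. x \<le> 0 \<Longrightarrow> \<Psi> x = \<Psi> 0" "\<And>x. x \<ge> 1 \<Longrightarrow> \<Psi> x = \<Psi> 1"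
    and s: "0 < e" "0 < s1" "s1 \<le> s2" "s2 + e < T"
  defines "\<phi> \<equiv> \<lambda>t. complex_of_real (\<Psi> ((t - s1) / e) - \<Psi> ((t - s2) / e))"
  shows "test_fun T \<phi>"
    and "dir_deriv 1 \<phi> t = complex_of_real (\<rho> ((t - s1) / e) / e - \<rho> ((t - s2) / e) / e)"
proof -
  have aff: "(\<lambda>t. \<Psi> ((t - s) / e)) \<in> flat_algebra" for s
    using flat_algebra.affine[OF step(1), of "1 / e" "- s / e"]
    by (simp add: diff_divide_distrib)
  have "(\<lambda>t. \<Psi> ((t - s1) / e) + (- 1) * \<Psi> ((t - s2) / e)) \<in> flat_algebra"
    by (rule flat_algebra.add[OF aff flat_algebra.mult[OF flat_algebra.const aff]])
  then have "smooth \<phi>"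
    using smooth_flat_algebra[of "\<lambda>t. \<Psi> ((t - s1) / e) - \<Psi> ((t - s2) / e)"] by (simp add: \<phi>_def)
  moreover have "\<phi> t = 0" if "t \<notin> {s1..s2 + e}" for t
  proof (cases "t < s1")
    case True
    then show ?thesis
      using s step(3)[of "(t - s1) / e"] step(3)[of "(t - s2) / e"]
      by (simp add: \<phi>_def divide_nonpos_pos)
  next
    case False
    then have "t > s2 + e" using that by auto
    then show ?thesis
      using s step(4)[of "(t - s1) / e"] step(4)[of "(t - s2) / e"]
      by (simp add: \<phi>_def pos_le_divide_eq)
  qed
  then have cl: "closure {t. \<phi> t \<noteq> 0} \<subseteq> {s1..s2 + e}"
    by (intro closure_minimal) (blast, simp)
  moreover have "compact (closure {t. \<phi> t \<noteq> 0})"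
    using cl by (meson bounded_closed_interval bounded_subset closed_closure compact_eq_bounded_closed)
  ultimately show "test_fun T \<phi>"
    using s by (force simp: test_fun_def)
  have der: "((\<lambda>t. \<Psi> ((t - s) / e)) has_real_derivative \<rho> ((t - s) / e) * (1 / e)) (at t)" for s
    by (rule DERIV_chain2[OF step(2)]) (use s in \<open>auto intro!: derivative_eq_intros\<close>)
  have "(\<phi> has_vector_derivative complex_of_real (\<rho> ((t - s1) / e) / e - \<rho> ((t - s2) / e) / e)) (at t)"
    unfolding \<phi>_def
    by (rule has_vector_derivative_of_real)
       (use DERIV_diff[OF der der] in \<open>simp add: has_real_derivative_iff_has_vector_derivative\<close>)
  then show "dir_deriv 1 \<phi> t = complex_of_real (\<rho> ((t - s1) / e) / e - \<rho> ((t - s2) / e) / e)"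
    by (rule dir_deriv_one)
qed

text \<open>Testing against a smoothed indicator function of \<open>[s1, s2]\<close>, whose derivative is a difference of two
  approximate identities concentrated at \<open>s1\<close> and \<open>s2\<close>.\<close>

lemma weak_derivative_zero_imp_constant:
  fixes Y :: "real \<Rightarrow> complex"
  assumes cont: "continuous_on {0..T} Y"
    and weak: "\<And>\<phi>. test_fun T \<phi> \<Longrightarrow> ((\<lambda>t. Y t * dir_deriv 1 \<phi> t) has_integral 0) {0..T}"
    and s: "0 < s1" "s1 < s2" "s2 < T"
  shows "Y s1 = Y s2"
proof -
  obtain \<Psi> \<rho> :: "real \<Rightarrow> real" where step:
    "\<Psi> \<in> flat_algebra" "\<rho> \<in> flat_algebra" "\<And>x. (\<Psi> has_real_derivative \<rho> x) (at x)"
    "\<And>x. \<rho> x \<ge> 0" "\<And>x. x \<notin> {0..1} \<Longrightarrow> \<rho> x = 0"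
    "\<And>x. x \<le> 0 \<Longrightarrow> \<Psi> x = \<Psi> 0" "\<And>x. x \<ge> 1 \<Longrightarrow> \<Psi> x = \<Psi> 1" "\<Psi> 0 < \<Psi> 1"
    by (rule flat_algebra_step) blast
  define m where "m = \<Psi> 1 - \<Psi> 0"
  have m: "m > 0" using step(8) by (simp add: m_def)
  have cont_\<rho>: "continuous_on A \<rho>" for A
    using flat_algebra_derivative[OF step(2)]
    by (meson DERIV_isCont continuous_at_imp_continuous_on)
  \<comment> \<open>The kernel has mass \<open>m\<close> and lives on [s, s + e], so the error is
    the integral of (Y t - Y s) against it and is controlled by the oscillation of Y there.\<close>
  have close: "cmod (integral {0..T} (\<lambda>t. Y t * complex_of_real (\<rho> ((t - s) / e) / e)) - m * Y s) \<le> \<eta> * m"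
    if e: "0 < e" "0 < s" "s + e < T" and \<eta>: "\<And>t. t \<in> {s..s+e} \<Longrightarrow> cmod (Y t - Y s) \<le> \<eta>" for s e \<eta>
  proof -
    have der: "((\<lambda>t. \<Psi> ((t - s) / e)) has_real_derivative \<rho> ((t - s) / e) * (1 / e)) (at t)" for t
      by (rule DERIV_chain2[OF step(3)]) (use e in \<open>auto intro!: derivative_eq_intros\<close>)
    have "((\<lambda>t. \<rho> ((t - s) / e) * (1 / e)) has_integral (\<Psi> ((T - s) / e) - \<Psi> ((0 - s) / e))) {0..T}"
      by (rule fundamental_theorem_of_calculus)
         (use der e in \<open>auto simp: has_real_derivative_iff_has_vector_derivative[symmetric]
            intro: has_field_derivative_at_within\<close>)
    moreover have "\<Psi> ((T - s) / e) = \<Psi> 1" "\<Psi> ((0 - s) / e) = \<Psi> 0"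
      using e step(6)[of "(0 - s) / e"] step(7)[of "(T - s) / e"]
      by (auto simp: pos_le_divide_eq divide_nonpos_pos)
    ultimately have int\<rho>: "((\<lambda>t. \<rho> ((t - s) / e) / e) has_integral m) {0..T}"
      by (simp add: m_def)
    have cont\<rho>e: "continuous_on {0..T} (\<lambda>t. \<rho> ((t - s) / e) / e)"
      using e by (intro continuous_intros continuous_on_compose2[OF cont_\<rho>[of UNIV]]) auto
    have "integral {0..T} (\<lambda>t. Y t * complex_of_real (\<rho> ((t - s) / e) / e)) - m * Y s
        = integral {0..T} (\<lambda>t. (Y t - Y s) * complex_of_real (\<rho> ((t - s) / e) / e))"
    proof -
      have "((\<lambda>t. complex_of_real (\<rho> ((t - s) / e) / e)) has_integral m) {0..T}"
        by (rule has_integral_of_real[OF int\<rho>])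
      then have 1: "((\<lambda>t. Y s * complex_of_real (\<rho> ((t - s) / e) / e)) has_integral Y s * m) {0..T}"
        by (rule has_integral_mult_right)
      have "(\<lambda>t. Y t * complex_of_real (\<rho> ((t - s) / e) / e)) integrable_on {0..T}"
        by (intro integrable_continuous_real continuous_intros cont cont\<rho>e)
      from has_integral_diff[OF integrable_integral[OF this] 1] show ?thesis
        by (simp only: left_diff_distrib mult.commute[of "complex_of_real m"] integral_unique)
    qed
    also have "cmod \<dots> \<le> integral {0..T} (\<lambda>t. \<eta> * (\<rho> ((t - s) / e) / e))"
    proof (rule integral_norm_bound_integral)
      show "(\<lambda>t. (Y t - Y s) * complex_of_real (\<rho> ((t - s) / e) / e)) integrable_on {0..T}"
        by (intro integrable_continuous_real continuous_intros cont cont\<rho>e)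
      show "(\<lambda>t. \<eta> * (\<rho> ((t - s) / e) / e)) integrable_on {0..T}"
        by (intro integrable_continuous_real continuous_intros cont cont\<rho>e)
      fix t assume "t \<in> {0..T}"
      show "norm ((Y t - Y s) * complex_of_real (\<rho> ((t - s) / e) / e)) \<le> \<eta> * (\<rho> ((t - s) / e) / e)"
      proof (cases "t \<in> {s..s+e}")
        case True
        have "cmod (Y t - Y s) * (\<rho> ((t - s) / e) / e) \<le> \<eta> * (\<rho> ((t - s) / e) / e)"
          using \<eta>[OF True] step(4) e by (intro mult_right_mono) auto
        then show ?thesis using step(4) e by (simp add: norm_mult norm_divide)
      next
        case False
        then have "(t - s) / e \<notin> {0..1}" using e by (auto simp: field_simps)
        then show ?thesis using step(5) by simp
      qed
    qed
    also have "\<dots> = \<eta> * m"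
      using has_integral_mult_right[OF int\<rho>, of \<eta>] by (rule integral_unique)
    finally show ?thesis .
  qed
  have "cmod (Y s1 - Y s2) \<le> 2 * \<eta>" if \<eta>: "\<eta> > 0" for \<eta>
  proof -
    have "uniformly_continuous_on {0..T} Y"
      using cont by (rule compact_uniformly_continuous) simp
    then obtain d where d: "d > 0" "\<And>t t'. t \<in> {0..T} \<Longrightarrow> t' \<in> {0..T} \<Longrightarrow> dist t' t < d \<Longrightarrow> dist (Y t') (Y t) < \<eta>"
      using \<eta> unfolding uniformly_continuous_on_def by metis
    \<comment> \<open>One constraint keeps the kernels within the modulus of continuity
      \<open>d\<close>, the other keeps the support of the test function below T; the halves make
      both strict.\<close>
    define e where "e = min (d / 2) ((T - s2) / 2)"
    have e: "0 < e" "e < d" "s2 + e < T" using d s by (auto simp: e_def min_def field_simps)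
    have near: "cmod (Y t - Y s) \<le> \<eta>" if "t \<in> {s..s+e}" "s \<in> {s1, s2}" for s t
      using d(2)[of s t] that e s by (auto simp: dist_norm dist_real_def)
    let ?I = "\<lambda>s. integral {0..T} (\<lambda>t. Y t * complex_of_real (\<rho> ((t - s) / e) / e))"
    have bd: "cmod (?I s1 - m * Y s1) \<le> \<eta> * m" "cmod (?I s2 - m * Y s2) \<le> \<eta> * m"
      using close[of e s1 \<eta>] close[of e s2 \<eta>] near e s by auto
    have eq: "?I s1 = ?I s2"
    proof -
      have int: "(\<lambda>t. Y t * complex_of_real (\<rho> ((t - s) / e) / e)) integrable_on {0..T}" for s
        using e by (intro integrable_continuous_real continuous_intros cont
            continuous_on_compose2[OF cont_\<rho>[of UNIV]]) auto
      have "((\<lambda>t. Y t * complex_of_real (\<rho> ((t - s1) / e) / e - \<rho> ((t - s2) / e) / e)) has_integral 0) {0..T}"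
        using weak[OF test_fun_step(1)[OF step(1,3,6,7), of e s1 s2 T]]
          test_fun_step(2)[OF step(1,3,6,7), of e s1 s2 T] e s by simp
      then have "0 = integral {0..T} (\<lambda>t. Y t * complex_of_real (\<rho> ((t - s1) / e) / e)
          - Y t * complex_of_real (\<rho> ((t - s2) / e) / e))"
        by (auto simp: algebra_simps dest!: integral_unique)
      also have "\<dots> = ?I s1 - ?I s2"
        by (rule integral_diff[OF int int])
      finally show ?thesis by simp
    qed
    have split: "m * Y s1 - m * Y s2 = (?I s2 - m * Y s2) - (?I s1 - m * Y s1)"
    proof -
      have "p - q = (I - q) - (I - p)" for p q I :: complex by simp
      then show ?thesis unfolding eq .
    qed
    have "cmod (m * Y s1 - m * Y s2) \<le> 2 * \<eta> * m"
      unfolding split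
      using norm_triangle_ineq4[of "?I s2 - m * Y s2" "?I s1 - m * Y s1"] bd by linarith
    moreover have "cmod (m * Y s1 - m * Y s2) = m * cmod (Y s1 - Y s2)"
      using m by (simp add: norm_mult flip: right_diff_distrib)
    ultimately show ?thesis using m by simp
  qed
  \<comment> \<open>With this choice a positive distance would be at most half of itself.\<close>
  from this[of "cmod (Y s1 - Y s2) / 4"] show ?thesis by (cases "Y s1 = Y s2") auto
qed

lemma test_fun_vanishes:
  assumes "test_fun T \<phi>" "t \<notin> {0<..<T}"
  shows "\<phi> t = 0"
  using assms closure_subset[of "{t. \<phi> t \<noteq> 0}"] by (auto simp: test_fun_def)

lemma test_fun_derivative:
  assumes "test_fun T \<phi>"
  shows "(\<phi> has_vector_derivative dir_deriv 1 \<phi> t) (at t)" "continuous_on A \<phi>"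
    "continuous_on A (dir_deriv 1 \<phi>)"
proof -
  have \<phi>: "smooth \<phi>" "smooth (dir_deriv 1 \<phi>)"
    using assms by (auto simp: test_fun_def intro: smooth_dir_deriv)
  have "(\<phi> has_vector_derivative vector_derivative \<phi> (at t)) (at t)"
    using smooth_differentiable[OF \<phi>(1)] vector_derivative_works by blast
  then show "(\<phi> has_vector_derivative dir_deriv 1 \<phi> t) (at t)"
    using dir_deriv_one[of \<phi> _ t] by simp
  show "continuous_on A \<phi>" "continuous_on A (dir_deriv 1 \<phi>)"
    using \<phi>[THEN smooth_differentiable]
    by (auto intro!: continuous_at_imp_continuous_on differentiable_imp_continuous_within)
qed

text \<open>The du Bois-Reymond lemma: subtracting an antiderivative of \<open>w\<close> reduces to the case \<open>w = 0\<close>.\<close>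

lemma weak_derivative_imp_integral:
  fixes y w :: "real \<Rightarrow> complex"
  assumes T: "T > 0" and y: "continuous_on {0..T} y" and w: "continuous_on {0..T} w"
    and weak: "\<And>\<phi>. test_fun T \<phi> \<Longrightarrow>
      ((\<lambda>t. y t * dir_deriv 1 \<phi> t + w t * \<phi> t) has_integral 0) {0..T}"
    and t: "t \<in> {0..T}"
  shows "y t = y 0 + integral {0..t} w"
proof -
  define W where "W t = integral {0..t} w" for t
  have W: "(W has_vector_derivative w t) (at t within {0..T})" if "t \<in> {0..T}" for t
    unfolding W_def using w that by (rule integral_has_vector_derivative)
  then have contW: "continuous_on {0..T} W"
    by (meson continuous_on_eq_continuous_within has_vector_derivative_continuous)
  have weak': "((\<lambda>t. (y t - W t) * dir_deriv 1 \<phi> t) has_integral 0) {0..T}" if \<phi>: "test_fun T \<phi>" for \<phi>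
  proof -
    \<comment> \<open>The integrand is the derivative of W \<phi>, and \<phi> vanishes at both
      endpoints: \<open>W\<close> satisfies the same weak equation as \<open>y\<close>.\<close>
    have "((\<lambda>t. W t * dir_deriv 1 \<phi> t + w t * \<phi> t) has_integral (W T * \<phi> T - W 0 * \<phi> 0)) {0..T}"
      using T W test_fun_derivative(1)[OF \<phi>]
      by (intro fundamental_theorem_of_calculus has_vector_derivative_mult)
         (auto intro: has_vector_derivative_at_within)
    then have "((\<lambda>t. W t * dir_deriv 1 \<phi> t + w t * \<phi> t) has_integral 0) {0..T}"
      using test_fun_vanishes[OF \<phi>] by simp
    from has_integral_diff[OF weak[OF \<phi>] this] show ?thesis
      by (simp add: algebra_simps)
  qed
  have contY: "continuous_on {0..T} (\<lambda>t. y t - W t)"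
    by (intro continuous_intros y contW)
  have const: "y s1 - W s1 = y s2 - W s2" if "0 < s1" "s1 < s2" "s2 < T" for s1 s2
    using weak_derivative_zero_imp_constant[OF contY weak' that] .
  \<comment> \<open>Constancy is known only strictly inside the interval. The midpoint serves as
    reference there, and continuity extends the value to the endpoints, which brings in y 0.\<close>
  define c where "c = y (T/2) - W (T/2)"
  have inner: "y s - W s = c" if s: "s \<in> {0<..<T}" for s
  proof (rule linorder_cases[of s "T / 2"])
    assume "s < T / 2"
    then show ?thesis unfolding c_def using s T by (intro const) auto
  next
    assume "T / 2 < s"
    then show ?thesis unfolding c_def using s T by (intro const[symmetric]) auto
  next
    assume "s = T / 2"
    then show ?thesis by (simp only: c_def)
  qed
  have "y s - W s = c" if "s \<in> {0..T}" for s
    using continuous_constant_on_closure[of "{0<..<T}" "\<lambda>t. y t - W t" c s] contY inner that T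
    by simp
  then have "y t - W t = c" "y 0 - W 0 = c"
    using t T by auto
  moreover have "W 0 = 0" by (simp add: W_def)
  ultimately show ?thesis
    unfolding W_def by (metis add.commute diff_add_cancel diff_zero)
qed

text \<open>With A the primitive of \<open>a\<close>, the integrating factor gives (exp (-A) y)' = b
  exp (-A), and the equation at t = 0 forces y 0 = 0. Multiplying back combines exp (A t) exp (-A s)
  into the exponential of the integral over [s, t]; in this form a bound on \<open>a\<close> near t
  alone bounds the contribution of the s near t.\<close>

lemma linear_ode_solution:
  fixes y :: "real \<Rightarrow> complex" and a :: "real \<Rightarrow> real"
  assumes y: "continuous_on {0..T} y" and a: "continuous_on {0..T} a"
    and eq: "\<And>t. t \<in> {0..T} \<Longrightarrow> y t = integral {0..t} (\<lambda>s. a s * y s + b)"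
    and t: "t \<in> {0..T}"
  shows "y t = b * complex_of_real (integral {0..t} (\<lambda>s. exp (integral {s..t} a)))"
proof -
  define A where "A t = integral {0..t} a" for t
  define E where "E t = complex_of_real (exp (- A t))" for t
  have A: "(A has_real_derivative a s) (at s within {0..T})" if "s \<in> {0..T}" for s
    unfolding A_def has_real_derivative_iff_has_vector_derivative
    using a that by (rule integral_has_vector_derivative)
  have E: "(E has_vector_derivative complex_of_real (- a s * exp (- A s))) (at s within {0..T})"
    if "s \<in> {0..T}" for s
    unfolding E_def
    by (rule has_vector_derivative_of_real)
       (use A[OF that] in \<open>auto intro!: derivative_eq_intros
          simp flip: has_real_derivative_iff_has_vector_derivative\<close>)
  have "continuous_on {0..T} (\<lambda>s. a s * y s + b)"
    by (intro continuous_intros y a)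
  then have "(y has_vector_derivative a s * y s + b) (at s within {0..T})" if "s \<in> {0..T}" for s
    using has_vector_derivative_transform[OF that eq integral_has_vector_derivative[OF _ that]]
    by blast
  from has_vector_derivative_mult[OF E this]
  have "((\<lambda>s. E s * y s) has_vector_derivative b * complex_of_real (exp (- A s))) (at s within {0..T})"
    if "s \<in> {0..T}" for s
    using that by (auto simp: E_def algebra_simps)
  then have "((\<lambda>s. b * complex_of_real (exp (- A s))) has_integral E t * y t - E 0 * y 0) {0..t}"
    using t by (intro fundamental_theorem_of_calculus)
      (auto intro!: has_vector_derivative_within_subset[where S = "{0..T}" and T = "{0..t}"])
  moreover have "y 0 = 0" using eq[of 0] t by simp
  ultimately have int: "((\<lambda>s. complex_of_real (exp (A t)) * (b * complex_of_real (exp (- A s))))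
      has_integral complex_of_real (exp (A t)) * (E t * y t)) {0..t}"
    by (intro has_integral_mult_right) simp
  have Ey: "complex_of_real (exp (A t)) * (E t * y t) = y t"
    by (simp add: E_def exp_minus field_simps)
  have split: "A t = A s + integral {s..t} a" if "s \<in> {0..t}" for s
  proof -
    have "a integrable_on {0..t}"
      using a t by (intro integrable_continuous_real) (auto intro: continuous_on_subset)
    then show ?thesis
      unfolding A_def using that Henstock_Kurzweil_Integration.integral_combine[of 0 s t a] by simp
  qed
  have "complex_of_real (exp (A t)) * (b * complex_of_real (exp (- A s)))
      = b * complex_of_real (exp (integral {s..t} a))" if "s \<in> {0..t}" for s
    using split[OF that] by (simp add: exp_add exp_minus field_simps flip: of_real_mult)
  then have "((\<lambda>s. b * complex_of_real (exp (integral {s..t} a))) has_integral y t) {0..t}"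
    using int unfolding Ey by (rule has_integral_eq)
  moreover have "((\<lambda>s. b * complex_of_real (exp (integral {s..t} a)))
      has_integral b * complex_of_real (integral {0..t} (\<lambda>s. exp (integral {s..t} a)))) {0..t}"
  proof (intro has_integral_mult_right has_integral_of_real integrable_integral)
    have "continuous_on {0..T} A"
      using A DERIV_continuous unfolding continuous_on_eq_continuous_within by blast
    then have "continuous_on {0..t} (\<lambda>s. exp (A t - A s))"
      using t by (intro continuous_intros) (auto intro: continuous_on_subset)
    then have "continuous_on {0..t} (\<lambda>s. exp (integral {s..t} a))"
      by (rule continuous_on_eq) (use split in auto)
    then show "(\<lambda>s. exp (integral {s..t} a)) integrable_on {0..t}"
      by (rule integrable_continuous_real)
  qed
  ultimately show ?thesis by (rule has_integral_unique)
qed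

section \<open>Directional derivatives\<close>

lemma dir_deriv_eqI:
  "((\<lambda>s. f (x + s *\<^sub>R v)) has_vector_derivative d) (at 0) \<Longrightarrow> dir_deriv v f x = d"
  by (simp add: dir_deriv_def vector_derivative_at)

text \<open>\<open>dir_deriv\<close> looks only at the parameter value 0. Moving the base point
  along the line gives the derivative at every parameter, as differentiation under the integral
  requires.\<close>

lemma has_vector_derivative_line:
  assumes "\<And>x. f differentiable (at x)"
  shows "((\<lambda>s. f (x + s *\<^sub>R v)) has_vector_derivative dir_deriv v f (x + t *\<^sub>R v)) (at t)"
proof -
  have "(\<lambda>s. (x + t *\<^sub>R v) + s *\<^sub>R v) differentiable (at 0)"
    by (intro derivative_intros)
  then have "f \<circ> (\<lambda>s. (x + t *\<^sub>R v) + s *\<^sub>R v) differentiable (at 0)"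
    by (rule differentiable_chain_at) (rule assms)
  then have "((\<lambda>s. f ((x + t *\<^sub>R v) + s *\<^sub>R v)) has_vector_derivative dir_deriv v f (x + t *\<^sub>R v)) (at 0)"
    unfolding dir_deriv_def o_def using vector_derivative_works by blast
  \<comment> \<open>The point 0 is written as t - t to match the chain rule with the inner function
    s - t.\<close>
  then have *: "((\<lambda>s. f ((x + t *\<^sub>R v) + s *\<^sub>R v)) has_vector_derivative dir_deriv v f (x + t *\<^sub>R v)) (at (t - t))"
    by simp
  have "((\<lambda>s. s - t) has_vector_derivative 1) (at t)"
    by (auto intro!: derivative_eq_intros)
  from vector_diff_chain_at[OF this *] show ?thesis
    by (simp add: o_def algebra_simps)
qed

lemma dir_deriv_mult:
  assumes "\<And>x. f differentiable (at x)" "\<And>x. g differentiable (at x)"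
  shows "dir_deriv v (\<lambda>x. f x * g x) x = f x * dir_deriv v g x + dir_deriv v f x * g x"
  using has_vector_derivative_mult[OF has_vector_derivative_line[of f x v 0] has_vector_derivative_line[of g x v 0]] assms
  by (intro dir_deriv_eqI) simp

lemma smooth_continuous: "smooth f \<Longrightarrow> continuous_on A f"
  by (meson continuous_at_imp_continuous_on differentiable_imp_continuous_within smooth_differentiable)

lemma smooth_torus_smooth: "w \<in> smooth_torus \<Longrightarrow> smooth w"
  by (simp add: smooth_torus_def)

lemma smooth_torus_periodic:
  "w \<in> smooth_torus \<Longrightarrow> w (x + (2 * pi) *\<^sub>R axis k 1) = w x"
  by (auto simp: smooth_torus_def axis_def)

lemma smooth_torus_dir_deriv:
  assumes "w \<in> smooth_torus"
  shows "dir_deriv (axis k 1) w \<in> smooth_torus"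
proof -
  have "dir_deriv (axis k 1) w (x + (2 * pi) *\<^sub>R p) = dir_deriv (axis k 1) w x"
    if "\<forall>j. p $ j \<in> \<int>" for x p
  proof -
    have "w (x + (2 * pi) *\<^sub>R p + s *\<^sub>R axis k 1) = w (x + s *\<^sub>R axis k 1)" for s
    proof -
      have "w (x + (2 * pi) *\<^sub>R p + s *\<^sub>R axis k 1) = w (x + s *\<^sub>R axis k 1 + (2 * pi) *\<^sub>R p)"
        by (simp add: algebra_simps)
      also have "\<dots> = w (x + s *\<^sub>R axis k 1)"
        using assms that by (simp add: smooth_torus_def)
      finally show ?thesis .
    qed
    then show ?thesis by (simp add: dir_deriv_def)
  qed
  then show ?thesis
    using assms smooth_dir_deriv[of w "axis k 1"] by (auto simp: smooth_torus_def axis_in_Basis_iff)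
qed

section \<open>Fourier coefficients\<close>

definition cell :: "(real^'n::finite) set" where
  "cell = cbox 0 (\<chi> i. 2 * pi)"

text \<open>The part of the cell that the shift moves out is moved back in by one period.\<close>

lemma integral_cell_shift:
  fixes w :: "real^'n::finite \<Rightarrow> complex"
  assumes cont: "continuous_on UNIV w"
    and per: "\<And>x. w (x + (2 * pi) *\<^sub>R axis k 1) = w x"
    and s: "0 \<le> s" "s \<le> 2 * pi"
  shows "integral cell (\<lambda>x. w (x + s *\<^sub>R axis k 1)) = integral cell w"
proof -
  let ?e = "axis k 1 :: real^'n"
  define b :: "real^'n" where "b = (\<chi> i. 2 * pi)"
  \<comment> \<open>In direction \<open>k\<close> the boxes cover [0, s], [s, 2 pi] and
    [2 pi, 2 pi + s]; in the other directions they are full. The cell is L with M, the shifted cell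
    is M with R, and R is L moved by one period.\<close>
  define L where "L = cbox 0 (b - (2 * pi - s) *\<^sub>R ?e)"
  define M where "M = cbox (s *\<^sub>R ?e) b"
  define R where "R = cbox ((2 * pi) *\<^sub>R ?e) (b + s *\<^sub>R ?e)"
  have e: "?e \<in> Basis" by (simp add: axis_in_Basis_iff)
  have int: "(w has_integral integral (cbox a c) w) (cbox a c)" for a c
    using cont by (intro integrable_integral integrable_continuous) (auto intro: continuous_on_subset)
  note I = int[where a = "0" and c = "b - (2 * pi - s) *\<^sub>R ?e", folded L_def]
    int[where a = "s *\<^sub>R ?e" and c = b, folded M_def]
    int[where a = "(2 * pi) *\<^sub>R ?e" and c = "b + s *\<^sub>R ?e", folded R_def]
  have split: "cbox a c \<inter> {x. x $ k \<le> d} = cbox a (\<chi> i. if i = k then min (c $ k) d else c $ i)"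
    "cbox a c \<inter> {x. x $ k \<ge> d} = cbox (\<chi> i. if i = k then max (a $ k) d else a $ i) c"
    for a c :: "real^'n" and d
    using interval_split_cart(1)[where a = a and b = c and k = k and c = d]
      interval_split_cart(2)[where a = a and b = c and k = k and c = d]
    by (simp_all add: interval_cbox_cart)
  have sets: "L = cbox 0 b \<inter> {x. x \<bullet> ?e \<le> s}" "M = cbox 0 b \<inter> {x. x \<bullet> ?e \<ge> s}"
    "M = cbox (s *\<^sub>R ?e) (b + s *\<^sub>R ?e) \<inter> {x. x \<bullet> ?e \<le> 2 * pi}"
    "R = cbox (s *\<^sub>R ?e) (b + s *\<^sub>R ?e) \<inter> {x. x \<bullet> ?e \<ge> 2 * pi}"
    using s unfolding L_def M_def R_def inner_axis inner_real_def mult_1_right split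
    by (auto simp: b_def vec_eq_iff axis_def intro!: arg_cong2[where f = cbox])
  have "(w has_integral integral L w + integral M w) (cbox 0 b)"
    using I sets by (intro has_integral_split[OF _ _ e, of _ _ _ _ s]) auto
  then have 1: "integral cell w = integral L w + integral M w"
    by (simp add: cell_def b_def integral_unique)
  have "(w has_integral integral M w + integral R w) (cbox (s *\<^sub>R ?e) (b + s *\<^sub>R ?e))"
    using I sets by (intro has_integral_split[OF _ _ e, of _ _ _ _ "2 * pi"]) auto
  then have 2: "integral (cbox (s *\<^sub>R ?e) (b + s *\<^sub>R ?e)) w = integral M w + integral R w"
    by (simp add: integral_unique)
  have "integral R w = integral L (w \<circ> (+) ((2 * pi) *\<^sub>R ?e))"
    unfolding L_def R_def integral_shift_cbox_plus by (simp add: algebra_simps)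
  also have "w \<circ> (+) ((2 * pi) *\<^sub>R ?e) = w"
    using per by (auto simp: add.commute)
  finally have "integral R w = integral L w" .
  moreover have "integral cell (\<lambda>x. w (x + s *\<^sub>R ?e)) = integral (cbox (s *\<^sub>R ?e) (b + s *\<^sub>R ?e)) w"
    using integral_shift_cbox_plus[of 0 b w "s *\<^sub>R ?e"]
    by (simp add: cell_def b_def o_def add.commute)
  ultimately show ?thesis using 1 2 by simp
qed

text \<open>The integral of the translate of \<open>w\<close> by s does not depend on s;
  differentiating it under the integral sign at s = 0 gives the claim. The one-sided derivative on
  [0, 1] is enough, and there the shift stays below one period.\<close>

lemma integral_cell_dir_deriv:
  fixes w :: "real^'n::finite \<Rightarrow> complex"
  assumes diff: "\<And>x. w differentiable (at x)"
    and cont: "continuous_on UNIV (dir_deriv (axis k 1) w)"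
    and per: "\<And>x. w (x + (2 * pi) *\<^sub>R axis k 1) = w x"
  shows "integral cell (dir_deriv (axis k 1) w) = 0"
proof -
  let ?e = "axis k 1 :: real^'n"
  let ?I = "\<lambda>s. integral cell (\<lambda>x. w (x + s *\<^sub>R ?e))"
  have cw: "continuous_on UNIV w"
    by (meson continuous_at_imp_continuous_on diff differentiable_imp_continuous_within)
  have "(?I has_vector_derivative integral cell (\<lambda>x. dir_deriv ?e w (x + 0 *\<^sub>R ?e))) (at 0 within {0..1})"
    unfolding cell_def
  proof (rule leibniz_rule_vector_derivative)
    show "((\<lambda>s. w (x + s *\<^sub>R ?e)) has_vector_derivative dir_deriv ?e w (x + s *\<^sub>R ?e)) (at s within {0..1})"
      for s x
      using has_vector_derivative_line[of w x ?e s] diff by (blast intro: has_vector_derivative_at_within)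
    show "(\<lambda>x. w (x + s *\<^sub>R ?e)) integrable_on cbox 0 (\<chi> i. 2 * pi)" for s
      by (intro integrable_continuous continuous_on_compose2[OF cw] continuous_intros) auto
    show "continuous_on ({0..1} \<times> cbox 0 (\<chi> i. 2 * pi)) (\<lambda>(s, x). dir_deriv ?e w (x + s *\<^sub>R ?e))"
      unfolding split_beta by (intro continuous_on_compose2[OF cont] continuous_intros) auto
  qed auto
  moreover have "?I s = integral cell w" if "s \<in> {0..1}" for s
    using that pi_gt3 by (intro integral_cell_shift cw per) auto
  then have "(?I has_vector_derivative 0) (at 0 within {0..1})"
    by (intro has_vector_derivative_transform[OF _ _ has_vector_derivative_const]) auto
  ultimately show ?thesis
    using vector_derivative_unique_within_closed_interval[of 0 1 0 ?I] by auto
qed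

definition character :: "'n \<Rightarrow> nat \<Rightarrow> real^'n::finite \<Rightarrow> complex" where
  "character j n x = exp (- (\<i> * of_nat n * complex_of_real (x $ j)))"

text \<open>The coefficients are not normalised by the volume of the cell, and only the frequencies
  \<open>n e\<^sub>j\<close> with \<open>n \<ge> 0\<close> occur.\<close>

definition fourier :: "'n \<Rightarrow> nat \<Rightarrow> (real^'n::finite \<Rightarrow> complex) \<Rightarrow> complex" where
  "fourier j n w = integral cell (\<lambda>x. w x * character j n x)"

lemma norm_character [simp]: "cmod (character j n x) = 1"
  by (simp add: character_def norm_exp_eq_Re)

lemma differentiable_coordinate: "(\<lambda>x::real^'n::finite. complex_of_real (x $ j)) differentiable (at x)"
  by (intro bounded_linear_imp_differentiable bounded_linear_compose[OF bounded_linear_of_real]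
      bounded_linear_vec_nth)

lemma differentiable_holomorphic_coordinate:
  fixes x :: "real^'n::finite"
  assumes "H holomorphic_on S" "open S" "complex_of_real (x $ j) \<in> S"
  shows "(\<lambda>x. H (complex_of_real (x $ j))) differentiable (at x)"
proof -
  have "H differentiable (at (complex_of_real (x $ j)))"
    using assms holomorphic_on_imp_differentiable_at field_differentiable_imp_differentiable by blast
  then have "H \<circ> (\<lambda>x. complex_of_real (x $ j)) differentiable (at x)"
    by (intro differentiable_chain_at differentiable_coordinate)
  then show ?thesis by (simp add: o_def)
qed

text \<open>For functions of one coordinate that extend holomorphically, partial derivatives become
  complex ones. This handles the characters as well as the source, and makes Cauchy estimates
  available for the latter.\<close>

lemma dir_deriv_holomorphic_coordinate:
  fixes x :: "real^'n::finite"
  assumes "H holomorphic_on S" "open S" "complex_of_real (x $ j) \<in> S"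
  shows "dir_deriv (axis k 1) (\<lambda>x. H (complex_of_real (x $ j))) x
    = (if k = j then deriv H (complex_of_real (x $ j)) else 0)"
proof (cases "k = j")
  case True
  have "((\<lambda>s. complex_of_real (x $ j + s)) has_vector_derivative complex_of_real 1) (at 0)"
    by (intro has_vector_derivative_of_real) (auto intro!: derivative_eq_intros)
  moreover have "(H has_field_derivative deriv H (complex_of_real (x $ j))) (at (complex_of_real (x $ j + 0)))"
    using holomorphic_derivI[OF assms] by simp
  ultimately have "(H \<circ> (\<lambda>s. complex_of_real (x $ j + s)) has_vector_derivative complex_of_real 1 * deriv H (complex_of_real (x $ j))) (at 0)"
    by (rule field_vector_diff_chain_at)
  then show ?thesis
    using True by (intro dir_deriv_eqI) (simp add: o_def)
next
  case False
  then show ?thesis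
    by (intro dir_deriv_eqI) (simp add: axis_def)
qed

lemma differentiable_character: "character j n differentiable (at x)"
proof -
  have "(\<lambda>z. exp (- (\<i> * of_nat n * z))) holomorphic_on UNIV"
    by (intro holomorphic_intros)
  then show ?thesis
    unfolding character_def[abs_def] by (rule differentiable_holomorphic_coordinate) auto
qed

lemma dir_deriv_character:
  "dir_deriv (axis k 1) (character j n) x = (if k = j then - \<i> * of_nat n * character j n x else 0)"
proof -
  have hol: "(\<lambda>z. exp (- (\<i> * of_nat n * z))) holomorphic_on UNIV"
    by (intro holomorphic_intros)
  have "deriv (\<lambda>z. exp (- (\<i> * of_nat n * z))) z = - \<i> * of_nat n * exp (- (\<i> * of_nat n * z))" for z
    by (rule DERIV_imp_deriv) (auto intro!: derivative_eq_intros)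
  then show ?thesis
    unfolding character_def[abs_def] by (simp add: dir_deriv_holomorphic_coordinate[OF hol])
qed

lemma continuous_character: "continuous_on A (character j n)"
  by (meson continuous_at_imp_continuous_on differentiable_imp_continuous_within differentiable_character)

lemma fourier_has_integral:
  assumes "continuous_on UNIV w"
  shows "((\<lambda>x. w x * character j n x) has_integral fourier j n w) cell"
  unfolding fourier_def cell_def
  using assms by (intro integrable_integral integrable_continuous continuous_intros continuous_character)
    (auto intro: continuous_on_subset)

lemma fourier_lincomb:
  assumes "continuous_on UNIV v" "continuous_on UNIV w"
  shows "fourier j n (\<lambda>x. a * v x + b * w x) = a * fourier j n v + b * fourier j n w"
proof -
  have "((\<lambda>x. a * (v x * character j n x) + b * (w x * character j n x)) has_integral
      a * fourier j n v + b * fourier j n w) cell"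
    by (intro has_integral_add has_integral_mult_right fourier_has_integral assms)
  then show ?thesis by (simp add: fourier_def algebra_simps integral_unique)
qed

lemma fourier_sum:
  assumes "finite K" "\<And>k. k \<in> K \<Longrightarrow> continuous_on UNIV (v k)"
  shows "fourier j n (\<lambda>x. \<Sum>k\<in>K. v k x) = (\<Sum>k\<in>K. fourier j n (v k))"
proof -
  have "((\<lambda>x. \<Sum>k\<in>K. v k x * character j n x) has_integral (\<Sum>k\<in>K. fourier j n (v k))) cell"
    using assms by (intro has_integral_sum fourier_has_integral)
  then show ?thesis by (simp add: fourier_def sum_distrib_right integral_unique)
qed

lemma fourier_mult_left: "fourier j n (\<lambda>x. c * w x) = c * fourier j n w"
  unfolding fourier_def by (simp add: mult.assoc)

lemma fourier_mult_right: "fourier j n (\<lambda>x. w x * c) = fourier j n w * c"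
  using fourier_mult_left[of j n c w] by (simp add: mult.commute)

lemma fourier_bound:
  fixes w :: "real^'n::finite \<Rightarrow> complex"
  assumes "continuous_on UNIV w" "\<And>x. cmod (w x) \<le> C"
  shows "cmod (fourier j n w) \<le> C * measure lborel (cell :: (real^'n) set)"
proof -
  have "C \<ge> 0" using assms(2) norm_ge_zero order_trans by blast
  then show ?thesis
    using has_integral_bound[OF _ fourier_has_integral[OF assms(1), unfolded cell_def], of C] assms(2)
    by (simp add: cell_def norm_mult)
qed

text \<open>Integration by parts without boundary terms: w times the character is periodic, so its
  derivative integrates to zero over the cell. The frequency n e_j has a component only in direction
  \<open>j\<close>.\<close>

lemma fourier_dir_deriv:
  assumes w: "w \<in> smooth_torus"
  shows "fourier j n (dir_deriv (axis k 1) w) = (if k = j then \<i> * of_nat n * fourier j n w else 0)"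
proof -
  have diff: "w differentiable (at x)" for x
    using w smooth_torus_smooth smooth_differentiable by blast
  have cont: "continuous_on UNIV w" "continuous_on UNIV (dir_deriv (axis k 1) w)"
    using w smooth_torus_dir_deriv smooth_torus_smooth smooth_continuous by blast+
  let ?c = "if k = j then - \<i> * of_nat n else 0"
  have d: "dir_deriv (axis k 1) (\<lambda>x. w x * character j n x)
      = (\<lambda>x. ?c * (w x * character j n x) + dir_deriv (axis k 1) w x * character j n x)"
    by (simp add: fun_eq_iff dir_deriv_mult diff differentiable_character dir_deriv_character)
  have "integral cell (dir_deriv (axis k 1) (\<lambda>x. w x * character j n x)) = 0"
  proof (rule integral_cell_dir_deriv)
    show "(\<lambda>x. w x * character j n x) differentiable (at x)" for x
      by (intro differentiable_mult diff differentiable_character)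
    show "continuous_on UNIV (dir_deriv (axis k 1) (\<lambda>x. w x * character j n x))"
      unfolding d by (intro continuous_intros cont continuous_character)
    have "character j n (x + (2 * pi) *\<^sub>R axis k 1) = character j n x" for x
    proof (cases "k = j")
      case True
      have "exp (- (2 * of_real pi * \<i> * of_nat n)) = 1"
        using exp_integer_2pi[of "- of_nat n"] by (simp add: mult_ac)
      then show ?thesis
        using True by (simp add: character_def algebra_simps exp_diff exp_minus)
    qed (simp add: character_def axis_def)
    then show "w (x + (2 * pi) *\<^sub>R axis k 1) * character j n (x + (2 * pi) *\<^sub>R axis k 1)
        = w x * character j n x" for x
      using smooth_torus_periodic[OF w] by simp
  qed
  moreover have "((\<lambda>x. ?c * (w x * character j n x) + dir_deriv (axis k 1) w x * character j n x)
      has_integral ?c * fourier j n w + fourier j n (dir_deriv (axis k 1) w)) cell"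
    by (intro has_integral_add has_integral_mult_right fourier_has_integral cont)
  ultimately have "?c * fourier j n w + fourier j n (dir_deriv (axis k 1) w) = 0"
    unfolding d by (simp add: integral_unique)
  then show ?thesis by (auto simp: add_eq_0_iff split: if_splits)
qed

section \<open>Coefficients as continuous functionals on \<open>Comega\<close>\<close>

lemma D_multi_0: "D_multi (\<lambda>_. 0) f = f"
proof -
  have "foldr (\<lambda>j. D_coord j ^^ 0) js f = f" for js :: "'a list" by (induction js) auto
  then show ?thesis by (simp add: D_multi_def)
qed

text \<open>A coefficient is bounded by a multiple of the sup norm, which is the term of
  \<open>hnorm\<close> at the zero multi-index and hence below \<open>hnorm h\<close> for every h.
  The preimages of discs around 0 are therefore zero neighbourhoods of the inductive limit, and
  linearity moves them to every point.\<close>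

lemma fourier_Comega_dual: "fourier j n \<in> Comega_dual"
proof -
  let ?V = "measure lborel (cell :: (real^'a) set)"
  have smooth: "smooth f" if "f \<in> Comega" for f :: "real^'a \<Rightarrow> complex"
    using that by (simp add: Comega_def smooth_torus_def)
  have lin: "fourier j n (\<lambda>x. a * f x + b * g x) = a * fourier j n f + b * fourier j n g"
    if "f \<in> Comega" "g \<in> Comega" for f g :: "real^'a \<Rightarrow> complex" and a b
    using that by (intro fourier_lincomb smooth_continuous smooth)
  have nhd: "{f \<in> Comega. cmod (fourier j n f) < r} \<in> Comega_zero_nhds" if r: "r > 0" for r
    unfolding Comega_zero_nhds_def mem_Collect_eq
  proof (intro conjI allI impI)
    show "abs_convex {f \<in> Comega. cmod (fourier j n f) < r}"
      unfolding abs_convex_def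
    proof (intro ballI allI impI CollectI conjI)
      fix v w :: "real^'a \<Rightarrow> complex" and a b
      assume v: "v \<in> {f \<in> Comega. cmod (fourier j n f) < r}"
        and w: "w \<in> {f \<in> Comega. cmod (fourier j n f) < r}" and ab: "cmod a + cmod b \<le> 1"
      let ?m = "max (cmod (fourier j n v)) (cmod (fourier j n w))"
      show "(\<lambda>x. a * v x + b * w x) \<in> Comega" using v w by (auto intro: Comega_lincomb)
      have "cmod (fourier j n (\<lambda>x. a * v x + b * w x)) \<le> cmod a * cmod (fourier j n v) + cmod b * cmod (fourier j n w)"
        using v w norm_triangle_ineq[of "a * fourier j n v" "b * fourier j n w"] by (simp add: lin norm_mult)
      also have "\<dots> \<le> cmod a * ?m + cmod b * ?m"
        by (intro add_mono mult_left_mono) auto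
      also have "\<dots> = (cmod a + cmod b) * ?m" by (simp add: algebra_simps)
      also have "\<dots> \<le> 1 * ?m" using ab by (intro mult_right_mono) (auto simp: le_max_iff_disj)
      also have "\<dots> < r" using v w by auto
      finally show "cmod (fourier j n (\<lambda>x. a * v x + b * w x)) < r" .
    qed
  next
    fix h :: real assume h: "h > 0"
    \<comment> \<open>The added 1 keeps the denominator positive and makes the final estimate
      strict.\<close>
    define \<epsilon> where "\<epsilon> = r / (?V + 1)"
    have V: "?V + 1 > 0" by (smt (verit) measure_nonneg)
    then have \<epsilon>: "\<epsilon> > 0" using r by (simp add: \<epsilon>_def)
    have "cmod (fourier j n f) < r" if f: "f \<in> hspace h" "hnorm h f < ennreal \<epsilon>" for f
    proof -
      have "(SUP x. ennreal (cmod (f x))) \<le> hnorm h f"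
        unfolding hnorm_def using SUP_upper[of "\<lambda>_. 0" UNIV "\<lambda>\<alpha>. (SUP x. ennreal (cmod (D_multi \<alpha> f x))) /
           ennreal (h ^ midx_size \<alpha> * fact (midx_size \<alpha>))"]
        by (simp add: divide_ennreal_def D_multi_0 midx_size_def)
      then have "ennreal (cmod (f x)) \<le> ennreal \<epsilon>" for x
        using f(2) by (meson SUP_upper UNIV_I order_less_imp_le order_trans)
      then have "cmod (f x) \<le> \<epsilon>" for x using \<epsilon> by (simp add: ennreal_le_iff)
      then have "cmod (fourier j n f) \<le> \<epsilon> * ?V"
        using hspace_subset_Comega[OF h] f(1) smooth by (intro fourier_bound smooth_continuous) auto
      also have "\<dots> < \<epsilon> * (?V + 1)" using \<epsilon> by simp
      also have "\<dots> = r" using V by (simp add: \<epsilon>_def)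
      finally show ?thesis .
    qed
    then show "\<exists>\<epsilon>>0. {f \<in> hspace h. hnorm h f < ennreal \<epsilon>} \<subseteq> {f \<in> Comega. cmod (fourier j n f) < r}"
      using \<epsilon> hspace_subset_Comega[OF h] by (intro exI[of _ \<epsilon>]) auto
  qed auto
  have "continuous_map Comega_top euclidean (fourier j n)"
    unfolding continuous_map_def
  proof (intro conjI allI impI)
    fix U :: "complex set" assume "openin euclidean U"
    then have U: "open U" by simp
    show "openin Comega_top {f \<in> topspace Comega_top. fourier j n f \<in> U}"
      unfolding openin_Comega_top topspace_Comega_top Comega_open_def
    proof (intro conjI ballI)
      fix f :: "real^'a \<Rightarrow> complex" assume f: "f \<in> {f \<in> Comega. fourier j n f \<in> U}"
      then obtain r where r: "r > 0" "ball (fourier j n f) r \<subseteq> U"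
        using U open_contains_ball by blast
      have "(\<lambda>x. f x + v x) \<in> {f \<in> Comega. fourier j n f \<in> U}"
        if v: "v \<in> {f \<in> Comega. cmod (fourier j n f) < r}" for v
        using lin[of f v 1 1] Comega_lincomb[of f v 1 1] f v r(2)
        by (auto simp: dist_norm subset_iff)
      then show "\<exists>V\<in>Comega_zero_nhds. \<forall>v\<in>V. (\<lambda>x. f x + v x) \<in> {f \<in> Comega. fourier j n f \<in> U}"
        using nhd[OF r(1)] by blast
    qed auto
  qed auto
  then show ?thesis
    using lin by (simp add: Comega_dual_def)
qed

section \<open>A function with exponentially decaying Fourier coefficients\<close>

text \<open>The half-plane where exp (i z - 1) has modulus below 1; it contains the discs of radius
  1/2 around real points.\<close>

definition upper_strip :: "complex set" where
  "upper_strip = {z. Im z > - 1}"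

text \<open>The sum of exp (-n) exp (i n z) over n >= 0, kept in closed form: its coefficients are
  read off the denominator, without expanding the series.\<close>

definition geometric :: "complex \<Rightarrow> complex" where
  "geometric z = 1 / (1 - exp (\<i> * z - 1))"

lemma open_upper_strip: "open upper_strip"
  unfolding upper_strip_def by (intro open_Collect_less continuous_intros)

lemma of_real_in_upper_strip [simp]: "complex_of_real x \<in> upper_strip"
  by (simp add: upper_strip_def)

lemma norm_exp_upper_strip: "cmod (exp (\<i> * z - 1)) = exp (- Im z - 1)"
  by (simp add: norm_exp_eq_Re)

lemma geometric_denominator:
  assumes "z \<in> upper_strip"
  shows "1 - exp (\<i> * z - 1) \<noteq> 0"
proof
  assume "1 - exp (\<i> * z - 1) = 0"
  then have "exp (- Im z - 1) = 1"
    using norm_exp_upper_strip[of z] by simp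
  then show False using assms by (simp add: upper_strip_def)
qed

lemma geometric_holomorphic: "geometric holomorphic_on upper_strip"
  unfolding geometric_def[abs_def] using geometric_denominator by (intro holomorphic_intros) auto

text \<open>Each partial derivative again has the form K(x_j) with K holomorphic, K being zero once
  a direction other than \<open>j\<close> occurs.\<close>

lemma smooth_holomorphic_coordinate:
  fixes j :: "'n::finite"
  assumes "H holomorphic_on upper_strip"
  shows "smooth (\<lambda>x::real^'n. H (complex_of_real (x $ j)))"
proof -
  have "\<exists>K. K holomorphic_on upper_strip \<and>
      foldr dir_deriv vs (\<lambda>x::real^'n. H (complex_of_real (x $ j))) = (\<lambda>x. K (complex_of_real (x $ j)))"
    if "set vs \<subseteq> Basis" for vs
    using that
  proof (induction vs)
    case (Cons v vs)
    then obtain K where K: "K holomorphic_on upper_strip"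
      "foldr dir_deriv vs (\<lambda>x::real^'n. H (complex_of_real (x $ j))) = (\<lambda>x. K (complex_of_real (x $ j)))"
      by auto
    obtain k where v: "v = axis k 1" using Cons.prems by (auto simp: Basis_vec_def)
    have "dir_deriv v (\<lambda>x. K (complex_of_real (x $ j)))
        = (\<lambda>x. (\<lambda>z. if k = j then deriv K z else 0) (complex_of_real (x $ j)))"
      using dir_deriv_holomorphic_coordinate[OF K(1) open_upper_strip] by (auto simp: v)
    moreover have "(\<lambda>z. if k = j then deriv K z else 0) holomorphic_on upper_strip"
      using holomorphic_deriv[OF K(1) open_upper_strip] by (cases "k = j") auto
    ultimately show ?case using K(2) by auto
  qed (use assms in auto)
  moreover have "(\<lambda>x::real^'n. K (complex_of_real (x $ j))) differentiable (at x)"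
    if "K holomorphic_on upper_strip" for K x
    using differentiable_holomorphic_coordinate[OF that open_upper_strip] by simp
  ultimately show ?thesis
    unfolding smooth_def by fastforce
qed

lemma geometric_smooth_torus: "(\<lambda>x. geometric (complex_of_real (x $ j))) \<in> smooth_torus"
proof -
  have "geometric (complex_of_real ((x + (2 * pi) *\<^sub>R k) $ j)) = geometric (complex_of_real (x $ j))"
    if "\<forall>j. k $ j \<in> \<int>" for x k :: "real^'a"
  proof -
    have "k $ j \<in> \<int>" using that by blast
    then obtain m where m: "k $ j = real_of_int m" by (auto elim: Ints_cases)
    have "exp (\<i> * complex_of_real ((x + (2 * pi) *\<^sub>R k) $ j) - 1)
        = exp (\<i> * complex_of_real (x $ j) - 1 + 2 * of_int m * of_real pi * \<i>)"
      by (simp add: m algebra_simps)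
    also have "\<dots> = exp (\<i> * complex_of_real (x $ j) - 1)"
      using exp_integer_2pi[of "of_int m"] by (simp add: exp_add mult_ac)
    finally show ?thesis by (simp add: geometric_def)
  qed
  then show ?thesis
    using smooth_holomorphic_coordinate[OF geometric_holomorphic] by (simp add: smooth_torus_def)
qed

section \<open>Derivative bounds for the source\<close>

lemma coords_props: "distinct (coords :: 'n::finite list)" "set (coords :: 'n list) = UNIV"
proof -
  have "\<exists>js :: 'n list. distinct js \<and> set js = UNIV"
    using finite_distinct_list[of "UNIV :: 'n set"] by auto
  from someI_ex[OF this] show "distinct (coords :: 'n list)" "set (coords :: 'n list) = UNIV"
    by (auto simp: coords_def)
qed

text \<open>\<open>D_coord\<close> contributes a factor 1/i in direction \<open>j\<close> and kills
  the function in any other. A constant of modulus at most 1 covers both cases, so that one formula,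
  depending only on the order, bounds all multi-indices.\<close>

lemma D_coord_holomorphic_coordinate:
  fixes j :: "'n::finite"
  assumes "H holomorphic_on upper_strip" "cmod c \<le> 1"
  shows "\<exists>c'. cmod c' \<le> 1 \<and> (D_coord k ^^ m) (\<lambda>x::real^'n. c * H (complex_of_real (x $ j)))
    = (\<lambda>x. c' * (deriv ^^ m) H (complex_of_real (x $ j)))"
proof (induction m)
  case (Suc m)
  then obtain c' where c': "cmod c' \<le> 1" "(D_coord k ^^ m) (\<lambda>x::real^'n. c * H (complex_of_real (x $ j)))
    = (\<lambda>x. c' * (deriv ^^ m) H (complex_of_real (x $ j)))" by blast
  have hol: "(deriv ^^ m) H holomorphic_on upper_strip"
    using assms(1) open_upper_strip by (rule holomorphic_higher_deriv)
  have "D_coord k (\<lambda>x::real^'n. c' * (deriv ^^ m) H (complex_of_real (x $ j)))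
      = (\<lambda>x. (if k = j then c' / \<i> else 0) * (deriv ^^ Suc m) H (complex_of_real (x $ j)))"
    unfolding D_coord_def D_dir_def[abs_def]
    by (subst dir_deriv_cmult) (auto simp: dir_deriv_holomorphic_coordinate[OF hol open_upper_strip]
        intro!: differentiable_holomorphic_coordinate[OF hol open_upper_strip])
  moreover have "cmod (if k = j then c' / \<i> else 0) \<le> 1" using c'(1) by (simp add: norm_divide del: divide_i)
  ultimately show ?case using c'(2) by (intro exI[of _ "if k = j then c' / \<i> else 0"]) simp
qed (use assms in auto)

lemma D_multi_geometric:
  fixes j :: "'n::finite"
  shows "\<exists>c. cmod c \<le> 1 \<and> D_multi \<alpha> (\<lambda>x::real^'n. geometric (complex_of_real (x $ j)))
    = (\<lambda>x. c * (deriv ^^ midx_size \<alpha>) geometric (complex_of_real (x $ j)))"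
proof -
  have "\<exists>c. cmod c \<le> 1 \<and> foldr (\<lambda>j. D_coord j ^^ \<alpha> j) js (\<lambda>x::real^'n. geometric (complex_of_real (x $ j)))
    = (\<lambda>x. c * (deriv ^^ sum_list (map \<alpha> js)) geometric (complex_of_real (x $ j)))" for js
  proof (induction js)
    case Nil
    show ?case by (intro exI[of _ 1]) simp
  next
    case (Cons k js)
    then obtain c where c: "cmod c \<le> 1" "foldr (\<lambda>j. D_coord j ^^ \<alpha> j) js (\<lambda>x::real^'n. geometric (complex_of_real (x $ j)))
      = (\<lambda>x. c * (deriv ^^ sum_list (map \<alpha> js)) geometric (complex_of_real (x $ j)))" by blast
    have hol: "(deriv ^^ sum_list (map \<alpha> js)) geometric holomorphic_on upper_strip"
      using geometric_holomorphic open_upper_strip by (rule holomorphic_higher_deriv)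
    show ?case
      using D_coord_holomorphic_coordinate[OF hol c(1), where k = k and m = "\<alpha> k" and j = j] c(2) by (simp add: funpow_add)
  qed
  from this[of coords] show ?thesis
    using coords_props[where 'n = 'n] by (simp add: D_multi_def midx_size_def sum_list_distinct_conv_sum_set)
qed

text \<open>Cauchy estimates on discs of radius 1/2 around real points. There Im z >= -1/2, so the
  exponential has modulus at most exp (-1/2) and the function is at most 1 / (1 - exp (-1/2)); the
  summand 1 makes this strict, as the open target ball demands, and 2 is the inverse radius.\<close>

lemma norm_deriv_geometric_le:
  "cmod ((deriv ^^ m) geometric (complex_of_real x)) \<le> (1 / (1 - exp (- (1 / 2))) + 1) * 2 ^ m * fact m"
proof -
  define B where "B = 1 / (1 - exp (- (1 / 2) :: real)) + 1"
  have sub: "cball (complex_of_real x) (1 / 2) \<subseteq> {z. Im z \<ge> - (1 / 2)}"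
  proof
    fix z assume "z \<in> cball (complex_of_real x) (1 / 2)"
    then have "\<bar>Im (complex_of_real x - z)\<bar> \<le> 1 / 2"
      using abs_Im_le_cmod[of "complex_of_real x - z"] by (simp add: dist_norm)
    then show "z \<in> {z. Im z \<ge> - (1 / 2)}" by auto
  qed
  then have strip: "cball (complex_of_real x) (1 / 2) \<subseteq> upper_strip"
    by (force simp: upper_strip_def)
  have bd: "cmod (geometric z) < B" if "z \<in> cball (complex_of_real x) (1 / 2)" for z
  proof -
    have "cmod (exp (\<i> * z - 1)) \<le> exp (- (1 / 2))"
      using sub that unfolding norm_exp_upper_strip by auto
    then have "cmod (1 - exp (\<i> * z - 1)) \<ge> 1 - exp (- (1 / 2))"
      using norm_triangle_ineq2[of 1 "exp (\<i> * z - 1)"] unfolding norm_one by linarith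
    then have "cmod (geometric z) \<le> 1 / (1 - exp (- (1 / 2)))"
      unfolding geometric_def norm_divide norm_one by (intro divide_left_mono) (auto intro!: mult_pos_pos)
    then show ?thesis by (simp add: B_def)
  qed
  \<comment> \<open>The Cauchy estimate is for positive orders; order 0 is the bound on the function
    itself.\<close>
  have "cmod ((deriv ^^ m) geometric (complex_of_real x)) \<le> fact m * B / (1 / 2) ^ m"
  proof (cases "m = 0")
    case True
    then show ?thesis using bd[of "complex_of_real x"] by simp
  next
    case False
    then show ?thesis
    proof (intro Cauchy_higher_deriv_bound[where y = 0])
      show "geometric holomorphic_on ball (complex_of_real x) (1 / 2)"
        using geometric_holomorphic strip ball_subset_cball by (meson holomorphic_on_subset order_trans)
      show "continuous_on (cball (complex_of_real x) (1 / 2)) geometric"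
        using geometric_holomorphic strip by (meson holomorphic_on_imp_continuous_on holomorphic_on_subset)
      show "geometric w \<in> ball 0 B" if "w \<in> ball (complex_of_real x) (1 / 2)" for w
        using bd[of w] that by simp
    qed auto
  qed
  then show ?thesis by (simp add: B_def power_one_over mult_ac)
qed

lemma geometric_Comega: "(\<lambda>x. geometric (complex_of_real (x $ j))) \<in> (Comega :: (real^'n::finite \<Rightarrow> complex) set)"
proof -
  let ?C = "1 / (1 - exp (- (1 / 2) :: real)) + 1"
  have "cmod (D_multi \<alpha> (\<lambda>x::real^'n. geometric (complex_of_real (x $ j))) x)
      \<le> ?C * 2 ^ midx_size \<alpha> * fact (midx_size \<alpha>)" for \<alpha> x
  proof -
    obtain c where c: "cmod c \<le> 1" "D_multi \<alpha> (\<lambda>x::real^'n. geometric (complex_of_real (x $ j)))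
      = (\<lambda>x. c * (deriv ^^ midx_size \<alpha>) geometric (complex_of_real (x $ j)))"
      using D_multi_geometric by blast
    have "cmod (D_multi \<alpha> (\<lambda>x::real^'n. geometric (complex_of_real (x $ j))) x)
        \<le> 1 * cmod ((deriv ^^ midx_size \<alpha>) geometric (complex_of_real (x $ j)))"
      unfolding c(2) norm_mult using c(1) by (rule mult_right_mono) simp
    also have "\<dots> \<le> ?C * 2 ^ midx_size \<alpha> * fact (midx_size \<alpha>)"
      using norm_deriv_geometric_le by simp
    finally show ?thesis .
  qed
  moreover have "?C > 0" by (intro add_pos_pos divide_pos_pos) auto
  ultimately show ?thesis
    unfolding Comega_def using geometric_smooth_torus
    by (intro CollectI conjI exI[of _ ?C] exI[of _ 2] allI) (simp_all del: power_one_right)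
qed

text \<open>This is the identity \<open>F (1 - exp (i x\<^sub>j - 1)) = 1\<close> on the Fourier side.\<close>

lemma fourier_geometric_Suc:
  "fourier j (Suc n) (\<lambda>x. geometric (complex_of_real (x $ j)))
    = exp (- 1) * fourier j n (\<lambda>x. geometric (complex_of_real (x $ j)))"
proof -
  let ?F = "\<lambda>x::real^'a. geometric (complex_of_real (x $ j))"
  have F: "continuous_on UNIV ?F"
    using geometric_smooth_torus smooth_torus_smooth smooth_continuous by blast
  have "smooth (\<lambda>x::real^'a. 1)"
    using smooth_holomorphic_coordinate[of "\<lambda>z. 1"] by simp
  \<comment> \<open>The derivative of the constant 1 vanishes, and the frequency n + 1 is nonzero
    and can be cancelled.\<close>
  then have "fourier j (Suc n) (dir_deriv (axis j 1) (\<lambda>x::real^'a. 1)) = \<i> * of_nat (Suc n) * fourier j (Suc n) (\<lambda>x. 1)"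
    by (subst fourier_dir_deriv) (auto simp: smooth_torus_def)
  moreover have "dir_deriv (axis j 1) (\<lambda>x::real^'a. 1) = (\<lambda>x. 0)"
    by (simp add: dir_deriv_def fun_eq_iff)
  ultimately have "fourier j (Suc n) (\<lambda>x::real^'a. 1) = 0"
    by (simp add: fourier_def del: of_nat_Suc)
  \<comment> \<open>Lowering the frequency by one multiplies the character by exp (i x_j), which
    produces the denominator of \<open>geometric\<close>.\<close>
  moreover have eq: "character j (Suc n) x = ?F x * character j (Suc n) x - exp (- 1) * (?F x * character j n x)" for x
  proof -
    have "exp (- 1) * character j n x = exp (\<i> * complex_of_real (x $ j) - 1) * character j (Suc n) x"
      by (simp add: character_def exp_add[symmetric] algebra_simps)
    then have "?F x * character j (Suc n) x - exp (- 1) * (?F x * character j n x)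
        = ?F x * (1 - exp (\<i> * complex_of_real (x $ j) - 1)) * character j (Suc n) x"
      by (simp add: algebra_simps)
    also have "?F x * (1 - exp (\<i> * complex_of_real (x $ j) - 1)) = 1"
      using geometric_denominator[of "complex_of_real (x $ j)"] by (simp add: geometric_def)
    finally show ?thesis by simp
  qed
  have "((\<lambda>x. character j (Suc n) x) has_integral fourier j (Suc n) ?F - exp (- 1) * fourier j n ?F) cell"
    using has_integral_diff[OF fourier_has_integral[OF F] has_integral_mult_right[OF fourier_has_integral[OF F]],
        of j "Suc n" "exp (- 1)" j n]
    by (simp only: flip: eq)
  ultimately show ?thesis
    by (simp add: fourier_def integral_unique)
qed

lemma fourier_geometric:
  "fourier j n (\<lambda>x. geometric (complex_of_real (x $ j)))
    = exp (- real n) * fourier j 0 (\<lambda>x. geometric (complex_of_real (x $ j)))"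
proof (induction n)
  case (Suc n)
  have "exp (- 1) * complex_of_real (exp (- real n)) = complex_of_real (exp (- real (Suc n)))"
    by (simp add: exp_of_real[symmetric] exp_add[symmetric])
  then show ?case
    unfolding fourier_geometric_Suc Suc.IH by (simp only: mult.assoc[symmetric])
qed simp

text \<open>The map 1 / (1 - z) sends the unit disc into the half-plane Re > 1/2, because 2 (1 - Re
  z) >= |1 - z|^2 amounts to |z| <= 1. The real part of the coefficient is therefore at least half
  the volume of the cell.\<close>

lemma fourier_geometric_0:
  "fourier j 0 (\<lambda>x::real^'n::finite. geometric (complex_of_real (x $ j))) \<noteq> 0"
proof -
  let ?F = "\<lambda>x::real^'n. geometric (complex_of_real (x $ j))"
  have F: "continuous_on UNIV ?F"
    using geometric_smooth_torus smooth_torus_smooth smooth_continuous by blast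
  have "(?F has_integral fourier j 0 ?F) cell"
    using fourier_has_integral[OF F, of j 0] by (simp add: character_def)
  then have 1: "((\<lambda>x. Re (?F x)) has_integral Re (fourier j 0 ?F)) cell"
    by (rule has_integral_Re)
  have Re: "Re (?F x) \<ge> 1 / 2" for x
  proof -
    define z where "z = exp (\<i> * complex_of_real (x $ j) - 1)"
    have "cmod z < 1" by (simp add: z_def norm_exp_eq_Re)
    then have z: "(Re z)\<^sup>2 + (Im z)\<^sup>2 < 1"
      using cmod_power2[of z] power_strict_mono[of "cmod z" 1 2] by simp
    have "z \<noteq> 1" using \<open>cmod z < 1\<close> by auto
    then have pos: "(1 - Re z)\<^sup>2 + (Im z)\<^sup>2 > 0"
      by (auto simp: complex_eq_iff sum_power2_gt_zero_iff)
    have "Re (1 / (1 - z)) = (1 - Re z) / ((1 - Re z)\<^sup>2 + (Im z)\<^sup>2)"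
      by (simp add: Re_divide)
    also have "\<dots> \<ge> 1 / 2"
      using pos z by (simp add: field_simps power2_eq_square)
    finally show ?thesis by (simp add: geometric_def z_def)
  qed
  have "((\<lambda>x::real^'n. 1 / 2 :: real) has_integral measure lborel (cell :: (real^'n) set) *\<^sub>R (1 / 2)) cell"
    unfolding cell_def by (rule has_integral_const)
  then have "measure lborel (cell :: (real^'n) set) *\<^sub>R (1 / 2) \<le> Re (fourier j 0 ?F)"
    by (rule has_integral_le) (use 1 Re in auto)
  moreover have "measure lborel (cell :: (real^'n) set) > 0"
    by (auto simp: cell_def content_cbox_if_cart interval_eq_empty_cart not_less intro!: prod_pos)
  ultimately show ?thesis by auto
qed

section \<open>The Fourier coefficients of a solution\<close>

text \<open>The symbol at the frequency n e_j is i times a real number. Against D_t = -i d/dt this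
  gives a real growth rate, and positive \<open>c2\<close> means growth.\<close>

lemma fourier_spatial_op:
  fixes w :: "real^'n::finite \<Rightarrow> complex"
  assumes w: "w \<in> smooth_torus"
  shows "fourier j n (spatial_op c2 c1 t w)
    = \<i> * complex_of_real (c2 t * (real n)\<^sup>2 + c1 j t * real n) * fourier j n w"
proof -
  have cont: "continuous_on UNIV v" if "v \<in> smooth_torus" for v :: "real^'n \<Rightarrow> complex"
    using that smooth_torus_smooth smooth_continuous by blast
  have cD: "continuous_on UNIV (D_coord k w)" for k
    using w smooth_torus_smooth smooth_D_coord smooth_continuous by blast
  have cL: "continuous_on UNIV (laplacian w)"
    unfolding laplacian_def[abs_def]
    by (intro continuous_on_sum cont smooth_torus_dir_deriv w)
  have FD: "fourier j n (D_coord k w) = (if k = j then of_nat n * fourier j n w else 0)" for k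
    unfolding D_coord_def D_dir_def[abs_def] fourier_mult_left fourier_dir_deriv[OF w]
    by (simp flip: mult.assoc)
  have FL: "fourier j n (laplacian w) = - (of_nat n)\<^sup>2 * fourier j n w"
  proof -
    have "fourier j n (laplacian w) = (\<Sum>k\<in>UNIV. fourier j n (dir_deriv (axis k 1) (dir_deriv (axis k 1) w)))"
      unfolding laplacian_def[abs_def]
      by (intro fourier_sum cont smooth_torus_dir_deriv w) simp
    also have "\<dots> = (\<Sum>k\<in>UNIV. if k = j then - (of_nat n)\<^sup>2 * fourier j n w else 0)"
      by (intro sum.cong) (auto simp: fourier_dir_deriv smooth_torus_dir_deriv w power2_eq_square algebra_simps)
    finally show ?thesis by simp
  qed
  have "fourier j n (spatial_op c2 c1 t w) = - \<i> * of_real (c2 t) * fourier j n (laplacian w)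
      + 1 * fourier j n (\<lambda>x. \<Sum>k\<in>UNIV. \<i> * of_real (c1 k t) * D_coord k w x)"
    unfolding spatial_op_def[abs_def]
    by (subst fourier_lincomb[symmetric]) (auto intro!: continuous_intros cL cD)
  also have "fourier j n (\<lambda>x. \<Sum>k\<in>UNIV. \<i> * of_real (c1 k t) * D_coord k w x)
      = (\<Sum>k\<in>UNIV. \<i> * of_real (c1 k t) * fourier j n (D_coord k w))"
    by (subst fourier_sum) (auto intro!: continuous_intros cD simp: fourier_mult_left)
  also have "\<dots> = (\<Sum>k\<in>UNIV. if k = j then \<i> * of_real (c1 k t) * (of_nat n * fourier j n w) else 0)"
    by (intro sum.cong) (auto simp: FD)
  finally show ?thesis
    by (simp add: FL algebra_simps)
qed

text \<open>Applying the coefficient functional to the integrals I, J, K, which are defined by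
  duality, leaves a scalar weak equation. The du Bois-Reymond lemma turns it into an integral
  equation, and the integrating factor solves that.\<close>

lemma fourier_solution:
  fixes u :: "real \<Rightarrow> real^'n::finite \<Rightarrow> complex" and F :: "real^'n \<Rightarrow> complex"
  assumes T: "T > 0" and c2: "continuous_on {0..T} c2" and c1: "continuous_on {0..T} (c1 j)"
    and u: "solves_cauchy T c2 c1 (\<lambda>t. F) (\<lambda>x. 0) u" and t: "t \<in> {0..T}"
  shows "fourier j n (u t) = \<i> * fourier j n F * complex_of_real
    (integral {0..t} (\<lambda>s. exp (integral {s..t} (\<lambda>r. c2 r * (real n)\<^sup>2 + c1 j r * real n))))"
proof -
  define a where "a r = c2 r * (real n)\<^sup>2 + c1 j r * real n" for r
  define y where "y t = fourier j n (u t)" for t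
  define b where "b = \<i> * fourier j n F"
  have a: "continuous_on {0..T} a"
    unfolding a_def by (intro continuous_intros c2 c1)
  have dual: "fourier j n \<in> Comega_dual" by (rule fourier_Comega_dual)
  have cm: "continuous_map (top_of_set {0..T}) Comega_top u"
    using u by (simp add: solves_cauchy_def C_Comega_def)
  have uC: "u t \<in> Comega" if "t \<in> {0..T}" for t
    using continuous_map_image_subset_topspace[OF cm] that by (auto simp: topspace_Comega_top)
  have y: "continuous_on {0..T} y"
    using continuous_map_compose[OF cm, of euclidean "fourier j n"] dual
    by (simp add: Comega_dual_def o_def y_def[abs_def])
  have y0: "y 0 = 0"
    using u by (simp add: solves_cauchy_def y_def fourier_def)
  have "((\<lambda>t. y t * dir_deriv 1 \<phi> t + (a t * y t + b) * \<phi> t) has_integral 0) {0..T}"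
    if \<phi>: "test_fun T \<phi>" for \<phi>
  proof -
    obtain I J K where int: "has_Comega_integral (\<lambda>t x. u t x * (- D_dir 1 \<phi> t)) I T"
      "has_Comega_integral (\<lambda>t x. spatial_op c2 c1 t (u t) x * \<phi> t) J T"
      "has_Comega_integral (\<lambda>t x. F x * \<phi> t) K T" and IJK: "\<And>x. I x + J x = K x"
      using u \<phi> unfolding solves_cauchy_def by blast
    have 1: "((\<lambda>t. fourier j n (\<lambda>x. u t x * (- D_dir 1 \<phi> t))) has_integral fourier j n I) {0..T}"
      "((\<lambda>t. fourier j n (\<lambda>x. spatial_op c2 c1 t (u t) x * \<phi> t)) has_integral fourier j n J) {0..T}"
      "((\<lambda>t. fourier j n (\<lambda>x. F x * \<phi> t)) has_integral fourier j n K) {0..T}"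
      and IJ: "I \<in> Comega" "J \<in> Comega"
      using int dual unfolding has_Comega_integral_def by blast+
    have "K = (\<lambda>x. 1 * I x + 1 * J x)" using IJK by auto
    then have "fourier j n K = 1 * fourier j n I + 1 * fourier j n J"
      using dual IJ unfolding Comega_dual_def by blast
    \<comment> \<open>Since -D_t \<phi> is i \<phi>', the factor -i isolates \<phi>', makes the rate
      real and turns the source term into b = i F_n.\<close>
    then have zero: "- \<i> * (fourier j n I + fourier j n J - fourier j n K) = 0" by simp
    have "((\<lambda>t. - \<i> * (fourier j n (\<lambda>x. u t x * (- D_dir 1 \<phi> t))
        + fourier j n (\<lambda>x. spatial_op c2 c1 t (u t) x * \<phi> t) - fourier j n (\<lambda>x. F x * \<phi> t)))
        has_integral 0) {0..T}"
      unfolding zero[symmetric]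
      by (intro has_integral_mult_right has_integral_diff has_integral_add 1)
    then show ?thesis
    proof (rule has_integral_eq[rotated])
      fix t assume "t \<in> {0..T}"
      then have "u t \<in> smooth_torus" using uC by (simp add: Comega_def)
      then show "- \<i> * (fourier j n (\<lambda>x. u t x * (- D_dir 1 \<phi> t))
          + fourier j n (\<lambda>x. spatial_op c2 c1 t (u t) x * \<phi> t) - fourier j n (\<lambda>x. F x * \<phi> t))
        = y t * dir_deriv 1 \<phi> t + (a t * y t + b) * \<phi> t"
        unfolding fourier_mult_right fourier_spatial_op[OF \<open>u t \<in> smooth_torus\<close>] D_dir_def
        by (simp add: y_def a_def b_def algebra_simps)
    qed
  qed
  then have "y t = y 0 + integral {0..t} (\<lambda>t. a t * y t + b)" if "t \<in> {0..T}" for t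
    using T that by (intro weak_derivative_imp_integral[where T = T] y continuous_intros a)
  then have "y t = b * complex_of_real (integral {0..t} (\<lambda>s. exp (integral {s..t} a)))"
    using t y0 by (intro linear_ode_solution[where T = T] y a) auto
  then show ?thesis by (simp add: y_def b_def a_def[abs_def])
qed

text \<open>The integrand is positive, so only s in [t0, t1 - d] is kept and nothing about
  \<open>a\<close> before t0 enters. One half of [t0, t1] is the range of s and gives the factor d;
  the other half lies in [s, t1] for all these s and gives the exponent d m.\<close>

lemma integral_exp_lower_bound:
  fixes a :: "real \<Rightarrow> real"
  assumes a: "continuous_on {0..t1} a" and t: "0 \<le> t0" "t0 < t1" and m: "m \<ge> 0"
    and ge: "\<And>r. r \<in> {t0..t1} \<Longrightarrow> a r \<ge> m"
  defines "d \<equiv> (t1 - t0) / 2"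
  shows "integral {0..t1} (\<lambda>s. exp (integral {s..t1} a)) \<ge> d * exp (d * m)"
proof -
  have "continuous_on {0..t1} (\<lambda>s. integral {0..t1} a - integral {0..s} a)"
    by (intro continuous_intros indefinite_integral_continuous_1 integrable_continuous_real a)
  then have "continuous_on {0..t1} (\<lambda>s. integral {s..t1} a)"
  proof (rule continuous_on_eq)
    show "integral {0..t1} a - integral {0..s} a = integral {s..t1} a" if "s \<in> {0..t1}" for s
      using Henstock_Kurzweil_Integration.integral_combine[of 0 s t1 a] integrable_continuous_real[OF a] that
      by simp
  qed
  then have cont: "continuous_on {0..t1} (\<lambda>s. exp (integral {s..t1} a))"
    by (intro continuous_intros)
  have int: "(\<lambda>s. exp (integral {s..t1} a)) integrable_on {p..q}" if "0 \<le> p" "q \<le> t1" for p q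
    using that by (intro integrable_continuous_real continuous_on_subset[OF cont]) auto
  have exp_ge: "exp (integral {s..t1} a) \<ge> exp (d * m)" if s: "s \<in> {t0..t1 - d}" for s
  proof -
    have "d * m \<le> (t1 - s) * m" using s m by (intro mult_right_mono) auto
    also have "\<dots> = integral {s..t1} (\<lambda>r. m)" using s t by (auto simp: d_def field_simps)
    also have "\<dots> \<le> integral {s..t1} a"
      using s t ge by (intro integral_le integrable_continuous_real continuous_on_subset[OF a]) auto
    finally show ?thesis by simp
  qed
  have "d * exp (d * m) = integral {t0..t1 - d} (\<lambda>s. exp (d * m))"
    using t by (simp add: d_def field_simps)
  also have "\<dots> \<le> integral {t0..t1 - d} (\<lambda>s. exp (integral {s..t1} a))"
    using t exp_ge by (intro integral_le int) (auto simp: d_def)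
  also have "\<dots> \<le> integral {0..t1} (\<lambda>s. exp (integral {s..t1} a))"
    using t by (intro integral_subset_le int) (auto simp: d_def)
  finally show ?thesis .
qed

lemma fourier_bounded:
  fixes w :: "real^'n::finite \<Rightarrow> complex"
  assumes "w \<in> Comega"
  shows "\<exists>B. \<forall>n. cmod (fourier j n w) \<le> B"
proof -
  obtain C h where C: "\<And>\<alpha> x. cmod (D_multi \<alpha> w x) \<le> C * h ^ midx_size \<alpha> * fact (midx_size \<alpha>)"
    using assms by (auto simp: Comega_def)
  have "cmod (w x) \<le> C" for x
    using C[of "\<lambda>_. 0" x] by (simp add: D_multi_0 midx_size_def)
  moreover have "continuous_on UNIV w"
    using assms smooth_continuous by (auto simp: Comega_def smooth_torus_def)
  ultimately show ?thesis using fourier_bound by blast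
qed

theorem theorem5p1:
  fixes T :: real
    and c2 :: "real \<Rightarrow> real"
    and c1 :: "'n::finite \<Rightarrow> real \<Rightarrow> real"
  assumes "T > 0"
    and "continuous_on {0..T} c2"
    and "\<And>j. continuous_on {0..T} (c1 j)"
    and "\<exists>t\<in>{0..T}. c2 t > 0"
  shows "\<exists>f g. f \<in> C_Comega T \<and> g \<in> Comega \<and> \<not> (\<exists>u. solves_cauchy T c2 c1 f g u)"
proof -
  \<comment> \<open>Any coordinate will do.\<close>
  define j :: 'n where "j = undefined"
  define F :: "real^'n \<Rightarrow> complex" where "F x = geometric (complex_of_real (x $ j))" for x
  have F: "F \<in> Comega"
    using geometric_Comega unfolding F_def[abs_def] .
  have "(\<lambda>t. F) \<in> C_Comega T"
    using F by (simp add: C_Comega_def topspace_Comega_top)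
  moreover have "(\<lambda>x. 0) \<in> (Comega :: (real^'n \<Rightarrow> complex) set)"
    using Comega_lincomb[OF F F, of 0 0] by simp
  moreover have False if u: "solves_cauchy T c2 c1 (\<lambda>t. F) (\<lambda>x. 0) u" for u
  proof -
    obtain ts where ts: "ts \<in> {0..T}" "c2 ts > 0" using assms(4) by blast
    define \<epsilon> where "\<epsilon> = c2 ts / 2"
    have \<epsilon>: "\<epsilon> > 0" using ts by (simp add: \<epsilon>_def)
    obtain r where r: "r > 0" "\<And>t. t \<in> {0..T} \<Longrightarrow> dist t ts < r \<Longrightarrow> dist (c2 t) (c2 ts) < \<epsilon>"
      using assms(2) ts(1) \<epsilon> unfolding continuous_on_iff by blast
    \<comment> \<open>Clipping to [0, T] allows \<open>ts\<close> to be an endpoint; r / 2 stays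
      strictly within the radius on which \<open>c2\<close> exceeds half its value at
      \<open>ts\<close>.\<close>
    define t0 where "t0 = max 0 (ts - r / 2)"
    define t1 where "t1 = min T (ts + r / 2)"
    have t01: "0 \<le> t0" "t0 < t1" "t1 \<le> T"
      using ts(1) r(1) assms(1) by (auto simp: t0_def t1_def)
    have c2_ge: "c2 t \<ge> \<epsilon>" if "t \<in> {t0..t1}" for t
    proof -
      have "t \<in> {0..T}" "\<bar>t - ts\<bar> < r"
        using that r(1) ts(1) by (auto simp: t0_def t1_def)
      from r(2)[OF this(1)] this(2) have "\<bar>c2 t - c2 ts\<bar> < \<epsilon>" by (simp add: dist_real_def)
      moreover have "c2 ts = 2 * \<epsilon>" by (simp add: \<epsilon>_def)
      ultimately show ?thesis by linarith
    qed
    have "bounded (c1 j ` {0..T})"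
      by (intro compact_imp_bounded compact_continuous_image assms) simp
    then obtain M where "\<forall>t\<in>{0..T}. \<bar>c1 j t\<bar> \<le> M"
      by (auto simp: bounded_iff)
    then have M: "\<bar>c1 j t\<bar> \<le> M" if "t \<in> {0..T}" for t
      using that by blast
    define d where "d = (t1 - t0) / 2"
    define l where "l = cmod (fourier j 0 F)"
    have d: "d > 0" and l: "l > 0"
      using t01 fourier_geometric_0[of j] by (auto simp: d_def l_def F_def[abs_def])
    have "continuous_map (top_of_set {0..T}) Comega_top u"
      using u by (simp add: solves_cauchy_def C_Comega_def)
    then have "u t1 \<in> Comega"
      using t01 continuous_map_image_subset_topspace[of "top_of_set {0..T}" Comega_top u]
      by (auto simp: topspace_Comega_top)
    then obtain B where B: "\<And>n. cmod (fourier j n (u t1)) \<le> B"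
      using fourier_bounded by blast
    \<comment> \<open>On [t0, t1] the rate is at least n (n \<epsilon> - M), and the summand -n is
      the decay of the source coefficient. The condition on n makes this lower bound nonnegative, as
      the integral estimate requires.\<close>
    have growth: "l * (d * exp (d * (real n * (real n * \<epsilon> - M)) - real n)) \<le> B"
      if n: "real n * \<epsilon> \<ge> M" for n
    proof -
      let ?a = "\<lambda>r. c2 r * (real n)\<^sup>2 + c1 j r * real n"
      let ?I = "integral {0..t1} (\<lambda>s. exp (integral {s..t1} ?a))"
      have "real n * (real n * \<epsilon> - M) \<le> ?a t" if t: "t \<in> {t0..t1}" for t
      proof -
        have "- M \<le> c1 j t" using M[of t] t t01 by auto
        then have "\<epsilon> * (real n)\<^sup>2 + (- M) * real n \<le> ?a t"
          using c2_ge[OF t] by (intro add_mono mult_right_mono) auto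
        then show ?thesis by (simp add: algebra_simps power2_eq_square)
      qed
      moreover have "continuous_on {0..t1} ?a"
        using t01 by (intro continuous_intros continuous_on_subset[OF assms(2)] continuous_on_subset[OF assms(3)]) auto
      ultimately have I: "d * exp (d * (real n * (real n * \<epsilon> - M))) \<le> ?I"
        unfolding d_def using t01 n by (intro integral_exp_lower_bound) auto
      have "l * (d * exp (d * (real n * (real n * \<epsilon> - M)) - real n))
          = exp (- real n) * l * (d * exp (d * (real n * (real n * \<epsilon> - M))))"
        unfolding exp_diff by (simp add: exp_minus divide_inverse)
      also have "\<dots> \<le> exp (- real n) * l * ?I"
        using I l by (intro mult_left_mono) auto
      also have "\<dots> = cmod (fourier j n (u t1))"
      proof -
        have "fourier j n F = exp (- real n) * fourier j 0 F"
          unfolding F_def[abs_def] by (rule fourier_geometric)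
        moreover have "?I \<ge> 0"
          by (rule order_trans[OF _ I]) (use d in simp)
        moreover have "fourier j n (u t1) = \<i> * fourier j n F * complex_of_real ?I"
          using t01 by (intro fourier_solution[OF assms(1-3) u]) auto
        ultimately show ?thesis by (simp add: l_def norm_mult)
      qed
      also have "\<dots> \<le> B" by (rule B)
      finally show ?thesis .
    qed
    \<comment> \<open>The first bound gives d (n \<epsilon> - M) >= 2, so the exponent is at least 2
      n - n = n and its exponential at least n. The second makes l d n exceed B.\<close>
    obtain n :: nat where n: "real n > max ((M + 2 / d) / \<epsilon>) (B / (l * d))"
      using reals_Archimedean2 by blast
    have "real n * \<epsilon> \<ge> M + 2 / d" using n \<epsilon> by (simp add: pos_divide_less_eq)
    moreover have "2 / d > 0" using d by simp
    ultimately have nM: "real n * \<epsilon> \<ge> M" and "2 / d \<le> real n * \<epsilon> - M" by linarith+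
    then have "d * (real n * \<epsilon> - M) \<ge> 2"
      using d by (simp add: pos_divide_le_eq mult.commute)
    then have "real n * (d * (real n * \<epsilon> - M)) \<ge> real n * 2"
      by (intro mult_left_mono) auto
    then have "real n \<le> d * (real n * (real n * \<epsilon> - M)) - real n"
      by (simp add: algebra_simps)
    also have "\<dots> \<le> exp (d * (real n * (real n * \<epsilon> - M)) - real n)"
      using exp_ge_add_one_self[of "d * (real n * (real n * \<epsilon> - M)) - real n"] by linarith
    finally have "l * (d * real n) \<le> l * (d * exp (d * (real n * (real n * \<epsilon> - M)) - real n))"
      using l d by (intro mult_left_mono) auto
    also have "\<dots> \<le> B" by (rule growth[OF nM])
    finally have "l * (d * real n) \<le> B" .
    moreover have "B < l * d * real n"
      using n l d by (simp add: pos_divide_less_eq mult.commute)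
    ultimately show False by (simp add: mult.assoc)
  qed
  ultimately show ?thesis by blast
qed

end
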